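(* Let $d\ge 1$, $m_\mu,m_\nu\in\mathbb{R}^d$ and $\Sigma_\mu,\Sigma_\nu\in\mathcal{S}_d^+$. Then there exists $(O,C)\in\mathcal{O}_d\times\mathfrak{C}_d$ such that $O^*\Sigma_\mu O$ and $O^*\Sigma_\nu O$ share the correlation matrix $C$. For any such couple $(O,C)$, setting $D_\mu=\mathrm{dg}(O^*\Sigma_\mu O)^{1/2}$ and $D_\nu=\mathrm{dg}(O^*\Sigma_\nu O)^{1/2}$, the Gaussian distribution $$\mathcal{N}_{2d}\left(\begin{pmatrix}m_\mu\\ m_\nu\end{pmatrix},\begin{pmatrix}\Sigma_\mu & O D_\mu C D_\nu O^*\\ O D_\nu C D_\mu O^* & \Sigma_\nu\end{pmatrix}\right)$$ is an optimal $\mathcal{W}_2$ coupling between $\mathcal{N}_d(m_\mu,\Sigma_\mu)$ and $\mathcal{N}_d(m_\nu,\Sigma_\nu)$, and $$\mathcal{W}_2^2\left(\mathcal{N}_d(m_\mu,\Sigma_\mu),\mathcal{N}_d(m_\nu,\Sigma_\nu)\right)=|m_\mu-m_\nu|^2+\mathbf{bw}^2(\Sigma_\mu,\Sigma_\nu)$$ with $$\mathbf{bw}^2(\Sigma_\mu,\Sigma_\nu)=\sum_{i=1}^d\left(\sqrt{(O^*\Sigma_\mu O)_{ii}}-\sqrt{(O^*\Sigma_\nu O)_{ii}}\right)^2.$$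
   Context: $\mathcal{S}_d^+$ is the set of real symmetric positive semi-definite $d\times d$ matrices (possibly singular). $\mathcal{O}_d$ is the set of real orthogonal $d\times d$ matrices. $M^*$ denotes the transpose of $M$, $\mathrm{tr}$ the trace, and $|\cdot|$ the Euclidean norm. For $\Sigma\in\mathcal{S}_d^+$, $\Sigma^{1/2}$ is the unique element of $\mathcal{S}_d^+$ with $\Sigma^{1/2}\Sigma^{1/2}=\Sigma$, and $\mathrm{dg}(\Sigma)=\mathrm{diag}(\Sigma_{11},\dots,\Sigma_{dd})$, so that $\mathrm{dg}(\Sigma)^{1/2}=\mathrm{diag}(\sqrt{\Sigma_{11}},\dots,\sqrt{\Sigma_{dd}})$. The set of correlation matrices is $\mathfrak{C}_d=\{C\in\mathcal{S}_d^+ : C_{ii}=1 \text{ for all } i\in\{1,\dots,d\}\}$. Two matrices $\Sigma_1,\Sigma_2\in\mathcal{S}_d^+$ are said to share the correlation matrix $C\in\mathfrak{C}_d$ if $\Sigma_i=\mathrm{dg}(\Sigma_i)^{1/2}\,C\,\mathrm{dg}(\Sigma_i)^{1/2}$ for $i\in\{1,2\}$. $\mathcal{N}_d(m,\Sigma)$ denotes the (possibly degenerate) Gaussian distribution on $\mathbb{R}^d$ with expectation $m$ and covariance matrix $\Sigma\in\mathcal{S}_d^+$. For probability measures $\mu,\nu$ on $\mathbb{R}^d$ with finite second order moment, $\Pi(\mu,\nu)$ is the set of probability measures on $\mathbb{R}^d\times\mathbb{R}^d$ with first marginal $\mu$ and second marginal $\nu$ (couplings), and the quadratic Wasserstein distance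 is $$\mathcal{W}_2(\mu,\nu)=\left(\inf_{\pi\in\Pi(\mu,\nu)}\int_{\mathbb{R}^d\times\mathbb{R}^d}|x-y|^2\,\pi(dx,dy)\right)^{1/2}.$$ An optimal $\mathcal{W}_2$ coupling between $\mu$ and $\nu$ is an element of $\Pi(\mu,\nu)$ attaining this infimum. The Bures-Wasserstein distance on $\mathcal{S}_d^+$ is defined by $$\mathbf{bw}(\Sigma_\mu,\Sigma_\nu)=\left(\mathrm{tr}\left(\Sigma_\mu+\Sigma_\nu-2\left(\Sigma_\mu^{1/2}\Sigma_\nu\Sigma_\mu^{1/2}\right)^{1/2}\right)\right)^{1/2}.$$ *)

theory Defs
  imports "HOL-Probability.Probability"
begin

definition psd_matrices :: "(real^'n^'n) set" where
  "psd_matrices = {A. transpose A = A \<and> (\<forall>x. 0 \<le> x \<bullet> (A *v x))}"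

text \<open>The description is meaningful only for positive semi-definite \<open>A\<close>; for these,
  existence and uniqueness of the root are standard.\<close>

definition psd_sqrt :: "real^'n^'n \<Rightarrow> real^'n^'n" where
  "psd_sqrt A = (THE S. S \<in> psd_matrices \<and> S ** S = A)"

definition dg :: "real^'n^'n \<Rightarrow> real^'n^'n" where
  "dg A = (\<chi> i j. if i = j then A $ i $ j else 0)"

definition correlation_matrices :: "(real^'n^'n) set" where
  "correlation_matrices = {C \<in> psd_matrices. \<forall>i. C $ i $ i = 1}"

definition share_correlation :: "real^'n^'n \<Rightarrow> real^'n^'n \<Rightarrow> real^'n^'n \<Rightarrow> bool" where
  "share_correlation S1 S2 C \<longleftrightarrow>
     S1 = psd_sqrt (dg S1) ** C ** psd_sqrt (dg S1) \<and>
     S2 = psd_sqrt (dg S2) ** C ** psd_sqrt (dg S2)"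

definition bw :: "real^'n^'n \<Rightarrow> real^'n^'n \<Rightarrow> real" where
  "bw S T = sqrt (trace (S + T - 2 *\<^sub>R psd_sqrt (psd_sqrt S ** T ** psd_sqrt S)))"

text \<open>The law of \<open>m + S\<^sup>1\<^sup>/\<^sup>2 Z\<close>, where \<open>Z\<close> has independent standard normal components. This
  covers singular \<open>S\<close>, for which there is no density.\<close>

definition gaussian :: "real^'n \<Rightarrow> real^'n^'n \<Rightarrow> (real^'n) measure" where
  "gaussian m S =
     distr (\<Pi>\<^sub>M i\<in>(UNIV :: 'n set). density lborel (\<lambda>x. ennreal (std_normal_density x))) borel
       (\<lambda>z. m + psd_sqrt S *v (\<chi> i. z i))"

definition couplings ::
  "'a::euclidean_space measure \<Rightarrow> 'a measure \<Rightarrow> ('a \<times> 'a) measure set" where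
  "couplings M N = {P. prob_space P \<and> sets P = sets (borel \<Otimes>\<^sub>M borel) \<and>
     distr P borel fst = M \<and> distr P borel snd = N}"

definition transport_cost :: "('a::euclidean_space \<times> 'a) measure \<Rightarrow> ennreal" where
  "transport_cost P = (\<integral>\<^sup>+ p. ennreal ((norm (fst p - snd p))\<^sup>2) \<partial>P)"

text \<open>When \<open>M\<close> and \<open>N\<close> are probability measures with finite second moments the infimum is
  finite, so that \<open>enn2real\<close> loses nothing.\<close>

definition W2 :: "'a::euclidean_space measure \<Rightarrow> 'a measure \<Rightarrow> real" where
  "W2 M N = sqrt (enn2real (INF P\<in>couplings M N. transport_cost P))"

definition optimal_W2_coupling ::
  "('a::euclidean_space \<times> 'a) measure \<Rightarrow> 'a measure \<Rightarrow> 'a measure \<Rightarrow> bool" where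
  "optimal_W2_coupling P M N \<longleftrightarrow>
     P \<in> couplings M N \<and> transport_cost P = (INF R\<in>couplings M N. transport_cost R)"

text \<open>Vectors of dimension \<open>2d\<close> are indexed by \<open>'n + 'n\<close>; the left summand carries the first
  block.\<close>

definition join_vec :: "real^'n \<Rightarrow> real^'n \<Rightarrow> real^('n + 'n)" where
  "join_vec x y = (\<chi> k. case k of Inl i \<Rightarrow> x $ i | Inr i \<Rightarrow> y $ i)"

definition split_vec :: "real^('n + 'n) \<Rightarrow> (real^'n) \<times> (real^'n)" where
  "split_vec z = (\<chi> i. z $ Inl i, \<chi> i. z $ Inr i)"

definition block_matrix ::
  "real^'n^'n \<Rightarrow> real^'n^'n \<Rightarrow> real^'n^'n \<Rightarrow> real^'n^'n \<Rightarrow> real^('n + 'n)^('n + 'n)" where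
  "block_matrix A B C D = (\<chi> k l. case k of
       Inl i \<Rightarrow> (case l of Inl j \<Rightarrow> A $ i $ j | Inr j \<Rightarrow> B $ i $ j)
     | Inr i \<Rightarrow> (case l of Inl j \<Rightarrow> C $ i $ j | Inr j \<Rightarrow> D $ i $ j))"

text \<open>The Gaussian law on dimension \<open>2d\<close>, transported along the identification of that space
  with the product of two copies of the \<open>d\<close>-dimensional one.\<close>

definition gaussian_pair ::
  "real^('n + 'n) \<Rightarrow> real^('n + 'n)^('n + 'n) \<Rightarrow> ((real^'n) \<times> (real^'n)) measure" where
  "gaussian_pair m S = distr (gaussian m S) (borel \<Otimes>\<^sub>M borel) split_vec"

end

theory Submission
  imports Defs
begin

text \<open>Fix an orthogonal \<open>Q\<close> and put \<open>a\<^sub>i = (Q\<^sup>T \<Sigma>\<^sub>\<mu> Q)\<^sub>i\<^sub>i\<close> and \<open>b\<^sub>i = (Q\<^sup>T \<Sigma>\<^sub>\<nu> Q)\<^sub>i\<^sub>i\<close>. In the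
  orthonormal basis of the columns of \<open>Q\<close> the squared Euclidean distance splits into one-dimensional
  pieces, and in direction \<open>i\<close> the Cauchy-Schwarz inequality bounds the covariance of any coupling by
  \<open>\<surd>a\<^sub>i \<surd>b\<^sub>i\<close>. So every coupling costs at least
  \<open>|m\<^sub>\<mu> - m\<^sub>\<nu>|\<^sup>2 + \<Sum>\<^sub>i (\<surd>a\<^sub>i - \<surd>b\<^sub>i)\<^sup>2\<close>, for every \<open>Q\<close> (\<open>transport_cost_coupling_ge\<close>).
  The bound is attained as soon as \<open>Q\<^sup>T \<Sigma>\<^sub>\<mu> Q\<close> and \<open>Q\<^sup>T \<Sigma>\<^sub>\<nu> Q\<close> share a correlation matrix \<open>C\<close>:
  if \<open>G\<close> is a Gaussian vector with covariance \<open>C\<close>, the \<open>i\<close>-th coordinates of \<open>D\<^sub>\<mu> G\<close> and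
  \<open>D\<^sub>\<nu> G\<close> are nonnegative multiples of the same variable, so their covariance is exactly
  \<open>\<surd>a\<^sub>i \<surd>b\<^sub>i\<close>. The joint law of \<open>m\<^sub>\<mu> + Q D\<^sub>\<mu> G\<close> and \<open>m\<^sub>\<nu> + Q D\<^sub>\<nu> G\<close> is the block Gaussian of the
  statement, and its cost is read off from its second moments
  (\<open>transport_cost_gaussian_pair\<close>).

  The existence of \<open>(Q, C)\<close> comes from the optimal transport map. If \<open>\<Sigma>\<^sub>\<mu>\<close> is invertible, there is a
  positive semi-definite \<open>T\<close> with \<open>T \<Sigma>\<^sub>\<mu> T = \<Sigma>\<^sub>\<nu>\<close>; in an eigenbasis of \<open>T\<close> it only
  rescales the coordinates, and rescaling preserves correlations. The singular case follows by
  applying this to \<open>\<Sigma>\<^sub>\<mu> + I / k\<close> and passing to the limit, since both the orthogonal and the correlation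
  matrices form compact sets (\<open>share_correlation_exists\<close>).

  Polar factors (\<open>polar_factor_exists\<close>: \<open>W W\<^sup>T = R R\<^sup>T\<close> forces \<open>W = R U\<close> with \<open>U\<close> orthogonal)
  are used twice. On the algebraic side they express \<open>\<Sigma>\<^sub>\<mu>\<^sup>1\<^sup>/\<^sup>2\<close> through \<open>C\<^sup>1\<^sup>/\<^sup>2 D\<^sub>\<mu>\<close>, which gives
  the trace of \<open>(\<Sigma>\<^sub>\<mu>\<^sup>1\<^sup>/\<^sup>2 \<Sigma>\<^sub>\<nu> \<Sigma>\<^sub>\<mu>\<^sup>1\<^sup>/\<^sup>2)\<^sup>1\<^sup>/\<^sup>2\<close> in closed form
  (\<open>trace_psd_sqrt_product\<close>). On the probabilistic side, together with the rotation invariance of the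
  standard Gaussian, they show that the law of \<open>m + W Z\<close> depends on \<open>W\<close> only through \<open>W W\<^sup>T\<close>
  (\<open>std_gaussian_affine_image\<close>); this identifies the marginals of the block Gaussian even when
  covariances are singular and no density is available.\<close>

section \<open>Positive semi-definite and diagonal matrices\<close>

lemma inner_matrix_vector_transpose:
  fixes A :: "real^'n^'m"
  shows "(A *v x) \<bullet> y = x \<bullet> (transpose A *v y)"
  by (metis dot_lmul_matrix inner_commute transpose_matrix_vector)

lemma psd_matrices_congruence:
  fixes W :: "real^'n^'m"
  assumes "A \<in> psd_matrices"
  shows "W ** A ** transpose W \<in> psd_matrices"
proof -
  have "x \<bullet> ((W ** A ** transpose W) *v x) = (transpose W *v x) \<bullet> (A *v (transpose W *v x))" for x
    by (metis inner_commute inner_matrix_vector_transpose matrix_vector_mul_assoc)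
  then show ?thesis
    using assms by (auto simp: psd_matrices_def matrix_transpose_mul matrix_mul_assoc)
qed

lemma gram_matrix_psd: "W ** transpose W \<in> psd_matrices" for W :: "real^'n^'m"
  using psd_matrices_congruence[of "mat 1" W] by (simp add: psd_matrices_def)

definition diag_matrix :: "('n \<Rightarrow> real) \<Rightarrow> real^'n^'n" where
  "diag_matrix f = (\<chi> i j. if i = j then f i else 0)"

lemma dg_eq_diag_matrix: "dg A = diag_matrix (\<lambda>i. A $ i $ i)"
  by (auto simp: dg_def diag_matrix_def vec_eq_iff)

lemma matrix_mult_diag_matrix: "(W ** diag_matrix f) $ i $ j = W $ i $ j * f j"
  for W :: "real^'n^'m"
  by (simp add: diag_matrix_def matrix_matrix_mult_def if_distrib cong: if_cong)

lemma diag_matrix_mult_matrix: "(diag_matrix f ** W) $ i $ j = f i * W $ i $ j"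
  for W :: "real^'m^'n"
  by (simp add: diag_matrix_def matrix_matrix_mult_def if_distrib if_distribR cong: if_cong)

lemma transpose_diag_matrix [simp]: "transpose (diag_matrix f) = diag_matrix f"
  by (auto simp: diag_matrix_def transpose_def vec_eq_iff)

lemma diag_matrix_mult_diag_matrix: "diag_matrix f ** diag_matrix g = diag_matrix (\<lambda>i. f i * g i)"
  by (simp add: vec_eq_iff matrix_mult_diag_matrix) (simp add: diag_matrix_def)

lemma diag_matrix_mult_vector: "diag_matrix f *v x = (\<chi> i. f i * x $ i)"
  by (simp add: diag_matrix_def matrix_vector_mult_def if_distrib if_distribR cong: if_cong)

lemma diag_matrix_psd_iff: "diag_matrix f \<in> psd_matrices \<longleftrightarrow> (\<forall>i. 0 \<le> f i)"
proof
  have ax: "axis i 1 \<bullet> (diag_matrix f *v axis i 1) = f i" for i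
    by (simp add: diag_matrix_mult_vector inner_axis')
  show "\<forall>i. 0 \<le> f i" if "diag_matrix f \<in> psd_matrices"
    using that ax unfolding psd_matrices_def by (metis (mono_tags, lifting) mem_Collect_eq)
  show "diag_matrix f \<in> psd_matrices" if "\<forall>i. 0 \<le> f i"
    using that by (auto simp: psd_matrices_def diag_matrix_mult_vector inner_vec_def intro!: sum_nonneg)
      (metis (no_types, lifting) mult.left_commute mult_nonneg_nonneg zero_le_square)
qed

lemma psd_matrices_diag_nonneg:
  assumes "A \<in> psd_matrices"
  shows "0 \<le> A $ i $ i"
proof -
  have "axis i 1 \<bullet> (A *v axis i 1) = A $ i $ i"
    by (simp add: inner_axis' matrix_vector_mult_basis column_def)
  then show ?thesis
    using assms unfolding psd_matrices_def by (metis (mono_tags, lifting) mem_Collect_eq)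
qed

section \<open>Spectral theorem and square roots\<close>

text \<open>Eigenvectors are found one at a time: the orthogonal complement of the eigenvectors found so far is
  invariant under \<open>A\<close>, and a maximiser of the quadratic form of \<open>A\<close> on its unit sphere is again
  an eigenvector.\<close>

lemma orthonormal_eigenvectors_exist:
  fixes A :: "real^'n^'n"
  assumes sym: "transpose A = A" and "k \<le> CARD('n)"
  shows "\<exists>B. finite B \<and> card B = k \<and> pairwise orthogonal B \<and>
           (\<forall>b\<in>B. norm b = 1 \<and> (\<exists>c. A *v b = c *\<^sub>R b))"
  using assms(2)
proof (induction k)
  case 0
  show ?case by (intro exI[of _ "{}"]) simp
next
  case (Suc k)
  then obtain B where B: "finite B" "card B = k" "pairwise orthogonal B"
      "\<And>b. b \<in> B \<Longrightarrow> norm b = 1" "\<And>b. b \<in> B \<Longrightarrow> \<exists>c. A *v b = c *\<^sub>R b"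
    by fastforce
  define V where "V = {x. \<forall>b\<in>B. b \<bullet> x = 0}"
  have symA: "(A *v x) \<bullet> y = x \<bullet> (A *v y)" for x y
    using inner_matrix_vector_transpose[of A x y] sym by simp
  have "dim B < DIM(real^'n)"
    using dim_le_card[of B B] B(1,2) Suc.prems by (simp add: span_superset)
  then obtain x0 where x0: "x0 \<noteq> 0" "\<And>y. y \<in> span B \<Longrightarrow> orthogonal x0 y"
    using orthogonal_to_subspace_exists by blast
  have x0V: "x0 \<in> V"
    using x0(2) by (auto simp: V_def orthogonal_def span_base inner_commute)
  have scaleV: "c *\<^sub>R x \<in> V" if "x \<in> V" for c x
    using that by (simp add: V_def)
  have addV: "x + y \<in> V" if "x \<in> V" "y \<in> V" for x y
    using that by (simp add: V_def inner_add_right)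
  have AV: "A *v x \<in> V" if "x \<in> V" for x
  proof -
    have "b \<bullet> (A *v x) = 0" if "b \<in> B" for b
      using B(5)[OF that] that \<open>x \<in> V\<close> by (auto simp: V_def simp flip: symA)
    then show ?thesis by (simp add: V_def)
  qed
  have "closed V"
  proof -
    have "V = (\<Inter>b\<in>B. {x. b \<bullet> x = 0})" by (auto simp: V_def)
    then show ?thesis by (simp add: closed_INT closed_hyperplane)
  qed
  then have "compact (sphere 0 1 \<inter> V)" by (intro compact_Int_closed) auto
  moreover have "(1 / norm x0) *\<^sub>R x0 \<in> sphere 0 1 \<inter> V"
    using x0(1) scaleV[OF x0V] by simp
  moreover have "continuous_on (sphere 0 1 \<inter> V) (\<lambda>x. x \<bullet> (A *v x))"
    by (intro continuous_intros linear_continuous_on linear_linear[THEN iffD2]) auto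
  ultimately obtain v where v: "v \<in> sphere 0 1 \<inter> V"
      and vmax: "\<And>x. x \<in> sphere 0 1 \<inter> V \<Longrightarrow> x \<bullet> (A *v x) \<le> v \<bullet> (A *v v)"
    using continuous_attains_sup[of "sphere 0 1 \<inter> V" "\<lambda>x. x \<bullet> (A *v x)"] by blast
  \<comment> \<open>The maximum of the Rayleigh quotient on \<open>V\<close>; it is going to be the eigenvalue of \<open>v\<close>.\<close>
  define l where "l = v \<bullet> (A *v v)"
  have nv: "norm v = 1" and vV: "v \<in> V" using v by auto
  \<comment> \<open>Homogeneity extends the bound from the unit sphere to all of \<open>V\<close>.\<close>
  have le: "x \<bullet> (A *v x) \<le> l * (x \<bullet> x)" if "x \<in> V" for x
  proof (cases "x = 0")
    case False
    have "(1 / norm x) *\<^sub>R x \<in> sphere 0 1 \<inter> V"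
      using False scaleV[OF that] by simp
    from vmax[OF this] have "(x \<bullet> (A *v x)) / (norm x)\<^sup>2 \<le> l"
      by (simp add: matrix_vector_mult_scaleR l_def power2_eq_square)
    then show ?thesis using False by (simp add: divide_simps dot_square_norm)
  qed simp
  define w where "w = A *v v - l *\<^sub>R v"
  have wV: "w \<in> V" using addV[OF AV[OF vV] scaleV[OF vV, of "-l"]] by (simp add: w_def)
  have vv: "v \<bullet> v = 1" using nv by (simp add: dot_square_norm)
  have vw: "v \<bullet> w = 0" using vv by (simp add: w_def inner_diff_right l_def)
  have wAv: "w \<bullet> (A *v v) = w \<bullet> w"
    using vw by (simp add: w_def inner_diff_right inner_commute)
  have wAv': "v \<bullet> (A *v w) = w \<bullet> w"
    using wAv symA[of v w] by (simp add: inner_commute)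
  \<comment> \<open>Maximality of \<open>v\<close> at the nearby point \<open>v + t w\<close>: the term linear in \<open>t\<close> must vanish, so \<open>w = 0\<close>.\<close>
  have ineq: "2 * t * (w \<bullet> w) \<le> t\<^sup>2 * (l * (w \<bullet> w) - w \<bullet> (A *v w))" for t
  proof -
    have "v + t *\<^sub>R w \<in> V" by (intro addV scaleV vV wV)
    from le[OF this] show ?thesis
      using vv vw wAv wAv' 
      by (simp add: matrix_vector_right_distrib matrix_vector_mult_scaleR inner_add_left
          inner_add_right inner_commute[of w v] l_def[symmetric] power2_eq_square algebra_simps)
  qed
  have "w \<bullet> w \<le> 0"
  proof (rule ccontr)
    assume "\<not> w \<bullet> w \<le> 0"
    then have p: "0 < w \<bullet> w" by linarith
    define q where "q = \<bar>l * (w \<bullet> w) - w \<bullet> (A *v w)\<bar> + 1"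
    have q: "0 < q" "l * (w \<bullet> w) - w \<bullet> (A *v w) \<le> q" by (auto simp: q_def)
    have "2 * ((w \<bullet> w) / q) * (w \<bullet> w) \<le> ((w \<bullet> w) / q)\<^sup>2 * q"
      using ineq[of "(w \<bullet> w) / q"] mult_left_mono[OF q(2) zero_le_power2, of "(w \<bullet> w) / q"]
      by linarith
    then have "(w \<bullet> w) * (w \<bullet> w) \<le> 0"
      using q(1) by (simp add: power2_eq_square divide_simps)
    then show False using mult_pos_pos[OF p p] by linarith
  qed
  then have "w = 0" by (metis inner_ge_zero inner_eq_zero_iff order_antisym)
  then have eig: "A *v v = l *\<^sub>R v" by (simp add: w_def)
  have "v \<notin> B"
    using vV vv by (auto simp: V_def)
  moreover have "pairwise orthogonal (insert v B)"
    using B(3) vV by (auto simp: pairwise_insert V_def orthogonal_def inner_commute)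
  ultimately show ?case
    using B eig nv by (intro exI[of _ "insert v B"]) auto
qed

theorem symmetric_matrix_diagonalisation:
  fixes A :: "real^'n^'n"
  assumes "transpose A = A"
  obtains Q f where "orthogonal_matrix Q" "A = Q ** diag_matrix f ** transpose Q"
proof -
  obtain B where B: "finite B" "card B = CARD('n)" "pairwise orthogonal B"
      "\<And>b. b \<in> B \<Longrightarrow> norm b = 1" "\<And>b. b \<in> B \<Longrightarrow> \<exists>c. A *v b = c *\<^sub>R b"
    using orthonormal_eigenvectors_exist[OF assms, of "CARD('n)"] by auto
  obtain e where e: "bij_betw e (UNIV :: 'n set) B"
    using finite_same_card_bij[of "UNIV :: 'n set" B] B(1,2) by auto
  define Q :: "real^'n^'n" where "Q = (\<chi> i j. e j $ i)"
  have eB: "e j \<in> B" for j using e by (auto simp: bij_betw_def)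
  obtain f where f: "\<And>j. A *v e j = f j *\<^sub>R e j"
    using B(5)[OF eB] by metis
  have dot: "e i \<bullet> e j = (if i = j then 1 else 0)" for i j
    using B(3) B(4)[OF eB] eB e
    by (auto simp: dot_square_norm pairwise_def orthogonal_def bij_betw_def inj_eq)
  have "transpose Q ** Q = mat 1"
    using dot by (auto simp: vec_eq_iff matrix_matrix_mult_def transpose_def Q_def mat_def inner_vec_def)
  then have Q: "orthogonal_matrix Q" by (simp add: orthogonal_matrix)
  have AQ: "A ** Q = Q ** diag_matrix f"
  proof -
    have "(A ** Q) $ i $ j = (A *v e j) $ i" for i j
      by (simp add: matrix_matrix_mult_def matrix_vector_mult_def Q_def)
    then show ?thesis
      by (simp add: vec_eq_iff matrix_mult_diag_matrix f) (simp add: Q_def mult.commute)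
  qed
  have "A = A ** Q ** transpose Q"
    using Q by (simp add: orthogonal_matrix_def flip: matrix_mul_assoc)
  then show ?thesis using that[OF Q] AQ by simp
qed

lemma psd_diagonalisation:
  assumes "A \<in> psd_matrices"
  obtains Q f where "orthogonal_matrix Q" "\<And>i. 0 \<le> f i"
    "A = Q ** diag_matrix f ** transpose Q"
proof -
  have "transpose A = A" using assms by (simp add: psd_matrices_def)
  then obtain Q f where Q: "orthogonal_matrix Q" and A: "A = Q ** diag_matrix f ** transpose Q"
    using symmetric_matrix_diagonalisation by blast
  have QQ: "transpose Q ** Q = mat 1" using Q by (simp add: orthogonal_matrix)
  have "transpose Q ** A ** Q = (transpose Q ** Q) ** diag_matrix f ** (transpose Q ** Q)"
    by (simp add: A matrix_mul_assoc)
  then have "diag_matrix f \<in> psd_matrices"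
    using psd_matrices_congruence[OF assms, of "transpose Q"] QQ by simp
  then show ?thesis using that[OF Q _ A] by (simp add: diag_matrix_psd_iff)
qed

lemma psd_square_root_exists:
  assumes "A \<in> psd_matrices"
  obtains S where "S \<in> psd_matrices" "S ** S = A"
proof -
  obtain Q f where Q: "orthogonal_matrix Q" and f: "\<And>i. 0 \<le> f i"
      and A: "A = Q ** diag_matrix f ** transpose Q"
    using psd_diagonalisation[OF assms] by blast
  have QQ: "transpose Q ** Q = mat 1" using Q by (simp add: orthogonal_matrix)
  define S where "S = Q ** diag_matrix (\<lambda>i. sqrt (f i)) ** transpose Q"
  have "S ** S = Q ** diag_matrix (\<lambda>i. sqrt (f i)) ** (transpose Q ** Q) **
      diag_matrix (\<lambda>i. sqrt (f i)) ** transpose Q"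
    by (simp add: S_def matrix_mul_assoc)
  also have "\<dots> = Q ** (diag_matrix (\<lambda>i. sqrt (f i)) ** diag_matrix (\<lambda>i. sqrt (f i))) ** transpose Q"
    by (simp add: QQ matrix_mul_assoc)
  also have "\<dots> = A"
    using f by (simp add: diag_matrix_mult_diag_matrix A)
  finally have "S ** S = A" .
  moreover have "S \<in> psd_matrices"
    unfolding S_def using f by (intro psd_matrices_congruence) (simp add: diag_matrix_psd_iff)
  ultimately show ?thesis using that by blast
qed

text \<open>If \<open>S\<^sup>2 = T\<^sup>2\<close>, then \<open>D = S - T\<close> satisfies \<open>S D + D T = 0\<close>. Testing this against an
  eigenvector of \<open>D\<close> shows that all eigenvalues of the symmetric matrix \<open>D\<close> vanish.\<close>

lemma psd_square_root_unique:
  assumes S: "S \<in> psd_matrices" and T: "T \<in> psd_matrices" and eq: "S ** S = T ** T"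
  shows "S = T"
proof -
  define D where "D = S - T"
  have symS: "transpose S = S" and symT: "transpose T = T"
    using S T by (auto simp: psd_matrices_def)
  then have "transpose D = D" by (simp add: D_def transpose_def vec_eq_iff)
  then obtain Q f where Q: "orthogonal_matrix Q" and D: "D = Q ** diag_matrix f ** transpose Q"
    using symmetric_matrix_diagonalisation by blast
  have "f i = 0" for i
  proof (rule ccontr)
    assume nz: "f i \<noteq> 0"
    define v where "v = Q *v axis i 1"
    have "D *v v = Q *v (diag_matrix f *v ((transpose Q ** Q) *v axis i 1))"
      by (simp only: v_def D matrix_vector_mul_assoc matrix_mul_assoc)
    also have "\<dots> = Q *v (diag_matrix f *v axis i 1)"
      using Q by (simp add: orthogonal_matrix)
    also have "diag_matrix f *v axis i 1 = f i *\<^sub>R axis i 1"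
      by (auto simp: diag_matrix_mult_vector vec_eq_iff axis_def)
    finally have Dv: "D *v v = f i *\<^sub>R v"
      by (simp add: v_def matrix_vector_mult_scaleR)
    have vv: "v \<bullet> v = 1"
    proof -
      have "v \<bullet> v = axis i 1 \<bullet> ((transpose Q ** Q) *v axis i (1::real))"
        by (simp only: v_def inner_matrix_vector_transpose matrix_vector_mul_assoc)
      then show ?thesis using Q by (simp add: orthogonal_matrix inner_axis_axis)
    qed
    have "v \<bullet> (S *v (D *v v)) + (D *v v) \<bullet> (T *v v) = 0"
    proof -
      have "v \<bullet> (S *v (D *v v)) = (S *v v) \<bullet> (D *v v)"
        using symS by (simp add: inner_matrix_vector_transpose)
      also have "\<dots> = (S *v v) \<bullet> (S *v v) - (S *v v) \<bullet> (T *v v)"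
        by (simp add: D_def matrix_vector_mult_diff_rdistrib inner_diff_right)
      finally have 1: "v \<bullet> (S *v (D *v v)) = (S *v v) \<bullet> (S *v v) - (S *v v) \<bullet> (T *v v)" .
      have 2: "(D *v v) \<bullet> (T *v v) = (S *v v) \<bullet> (T *v v) - (T *v v) \<bullet> (T *v v)"
        by (simp add: D_def matrix_vector_mult_diff_rdistrib inner_diff_left)
      have 3: "(S *v v) \<bullet> (S *v v) = v \<bullet> ((S ** S) *v v)"
        using symS by (simp only: inner_matrix_vector_transpose matrix_vector_mul_assoc)
      have 4: "(T *v v) \<bullet> (T *v v) = v \<bullet> ((T ** T) *v v)"
        using symT by (simp only: inner_matrix_vector_transpose matrix_vector_mul_assoc)
      from 1 2 3 4 show ?thesis by (simp add: eq)
    qed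
    then have "f i * (v \<bullet> (S *v v) + v \<bullet> (T *v v)) = 0"
      by (simp add: Dv matrix_vector_mult_scaleR distrib_left)
    then have "v \<bullet> (S *v v) + v \<bullet> (T *v v) = 0" using nz by simp
    moreover have "0 \<le> v \<bullet> (S *v v)" "0 \<le> v \<bullet> (T *v v)"
      using S T by (auto simp: psd_matrices_def)
    ultimately have "v \<bullet> (D *v v) = 0"
      by (simp add: D_def matrix_vector_mult_diff_rdistrib inner_diff_right)
    then show False using Dv vv nz by simp
  qed
  then have "diag_matrix f = 0" by (simp add: diag_matrix_def vec_eq_iff)
  then have "D = 0" by (simp add: D)
  then show ?thesis by (simp add: D_def)
qed

lemma psd_sqrt_eqI:
  assumes "S \<in> psd_matrices" "S ** S = A"
  shows "psd_sqrt A = S"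
  unfolding psd_sqrt_def using assms psd_square_root_unique by (intro the_equality) auto

lemma
  assumes "A \<in> psd_matrices"
  shows psd_sqrt_psd: "psd_sqrt A \<in> psd_matrices"
    and psd_sqrt_square: "psd_sqrt A ** psd_sqrt A = A"
  using psd_square_root_exists[OF assms] psd_sqrt_eqI by metis+

lemma psd_sqrt_symmetric: "A \<in> psd_matrices \<Longrightarrow> transpose (psd_sqrt A) = psd_sqrt A"
  using psd_sqrt_psd by (auto simp: psd_matrices_def)

lemma psd_sqrt_dg:
  assumes "A \<in> psd_matrices"
  shows "psd_sqrt (dg A) = diag_matrix (\<lambda>i. sqrt (A $ i $ i))"
  using psd_matrices_diag_nonneg[OF assms]
  by (intro psd_sqrt_eqI)
    (auto simp: diag_matrix_psd_iff diag_matrix_mult_diag_matrix dg_eq_diag_matrix)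

section \<open>Polar factors\<close>

text \<open>The reflection in the hyperplane orthogonal to \<open>v - w\<close>.\<close>

lemma reflection_swapping_vectors:
  fixes v w :: "'a::euclidean_space"
  assumes "norm v = norm w"
  obtains f where "orthogonal_transformation f" "f v = w" "\<And>x. x \<bullet> v = x \<bullet> w \<Longrightarrow> f x = x"
proof -
  define d where "d = v - w"
  \<comment> \<open>For \<open>v = w\<close> the quotient is \<open>0 / 0 = 0\<close>, and \<open>f\<close> is the identity.\<close>
  define f where "f x = x - (2 * (x \<bullet> d) / (d \<bullet> d)) *\<^sub>R d" for x
  have "linear f"
    by (intro linearI) (simp_all add: f_def inner_add_left algebra_simps add_divide_distrib)
  moreover have "f x \<bullet> f y = x \<bullet> y" for x y
    by (cases "d = 0") (simp_all add: f_def inner_diff_left inner_diff_right inner_commute field_simps)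
  ultimately have "orthogonal_transformation f"
    by (simp add: orthogonal_transformation_def)
  moreover have "f v = w"
  proof (cases "d = 0")
    case False
    have "d \<bullet> d = 2 * (v \<bullet> d)"
      using assms by (simp add: d_def inner_diff_left inner_diff_right inner_commute norm_eq)
    moreover have "d \<bullet> d \<noteq> 0" using False by simp
    ultimately have "2 * (v \<bullet> d) / (d \<bullet> d) = 1" by (metis divide_self)
    then have "f v = v - d" by (simp only: f_def scaleR_one)
    then show ?thesis by (simp add: d_def)
  qed (simp add: f_def d_def)
  moreover have "f x = x" if "x \<bullet> v = x \<bullet> w" for x
    using that by (simp add: f_def d_def inner_diff_right)
  ultimately show ?thesis using that by blast
qed

text \<open>Vectors are moved into place one at a time by reflections. If the first ones already agree,
  the reflection that corrects the next one fixes them, because the Gram matrices coincide.\<close>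

lemma same_gram_orthogonal_transformation:
  fixes r w :: "'i \<Rightarrow> 'a::euclidean_space"
  assumes "finite I" "\<And>i j. i \<in> I \<Longrightarrow> j \<in> I \<Longrightarrow> r i \<bullet> r j = w i \<bullet> w j"
  shows "\<exists>f. orthogonal_transformation f \<and> (\<forall>i\<in>I. f (r i) = w i)"
  using assms
proof (induction I rule: finite_induct)
  case empty
  show ?case using orthogonal_transformation_id by blast
next
  case (insert k I)
  then obtain f where f: "orthogonal_transformation f" "\<And>i. i \<in> I \<Longrightarrow> f (r i) = w i"
    by auto
  have fin: "f x \<bullet> f y = x \<bullet> y" for x y
    using f(1) by (simp add: orthogonal_transformation_def)
  have "norm (f (r k)) = norm (w k)"
    using fin[of "r k" "r k"] insert.prems[of k k] by (simp add: norm_eq)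
  then obtain g where g: "orthogonal_transformation g" "g (f (r k)) = w k"
      "\<And>x. x \<bullet> f (r k) = x \<bullet> w k \<Longrightarrow> g x = x"
    using reflection_swapping_vectors by blast
  have "g (f (r i)) = w i" if "i \<in> I" for i
    using that insert.prems[of i k] fin[of "r i" "r k"] by (simp add: g(3) f(2))
  with g(2) have "\<forall>i\<in>insert k I. (g \<circ> f) (r i) = w i" by simp
  then show ?case
    using orthogonal_transformation_compose[OF g(1) f(1)] by blast
qed

theorem polar_factor_exists:
  fixes W R :: "real^'m^'n"
  assumes "W ** transpose W = R ** transpose R"
  obtains U where "orthogonal_matrix U" "W = R ** U"
proof -
  have gram: "(X ** transpose X) $ i $ j = X $ i \<bullet> X $ j" for X :: "real^'m^'n" and i j
    by (simp add: matrix_matrix_mult_def transpose_def inner_vec_def)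
  have "R $ i \<bullet> R $ j = W $ i \<bullet> W $ j" for i j
    using assms gram by metis
  then obtain f where f: "orthogonal_transformation f" "\<And>i. f (R $ i) = W $ i"
    using same_gram_orthogonal_transformation[of UNIV "($) R" "($) W"] by auto
  define U where "U = transpose (matrix f)"
  have "orthogonal_matrix U"
    using f(1) by (simp add: U_def orthogonal_transformation_matrix)
  moreover have "W = R ** U"
  proof -
    have "(R ** U) $ i $ j = (matrix f *v (R $ i)) $ j" for i j
      by (simp add: matrix_matrix_mult_def matrix_vector_mult_def U_def transpose_def mult.commute)
    moreover have "matrix f *v x = f x" for x
      using f(1) by (simp add: matrix_works orthogonal_transformation_linear)
    ultimately show ?thesis by (simp add: vec_eq_iff f(2))
  qed
  ultimately show ?thesis using that by blast
qed

section \<open>Simultaneous reduction to a common correlation matrix\<close>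

text \<open>In this form the condition involves only matrix entries and square roots of diagonal entries, so it is
  stable under limits.\<close>

lemma share_correlation_iff:
  assumes "S1 \<in> psd_matrices" "S2 \<in> psd_matrices"
  shows "share_correlation S1 S2 C \<longleftrightarrow>
    (\<forall>i j. S1 $ i $ j = sqrt (S1 $ i $ i) * C $ i $ j * sqrt (S1 $ j $ j)) \<and>
    (\<forall>i j. S2 $ i $ j = sqrt (S2 $ i $ i) * C $ i $ j * sqrt (S2 $ j $ j))"
  unfolding share_correlation_def psd_sqrt_dg[OF assms(1)] psd_sqrt_dg[OF assms(2)]
  by (simp add: vec_eq_iff matrix_mult_diag_matrix diag_matrix_mult_matrix)

text \<open>With \<open>R = A\<^sup>1\<^sup>/\<^sup>2\<close>, the matrix \<open>T = R\<^sup>-\<^sup>1 (R B R)\<^sup>1\<^sup>/\<^sup>2 R\<^sup>-\<^sup>1\<close> is the optimal transport map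
  from the centred Gaussian of covariance \<open>A\<close> to that of covariance \<open>B\<close>: it is positive semi-definite
  and \<open>T A T = B\<close>. In an orthonormal eigenbasis of \<open>T\<close> the passage from \<open>A\<close> to \<open>B\<close> is a
  nonnegative rescaling of the coordinates, which leaves the correlation matrix of \<open>A\<close> unchanged.\<close>

lemma share_correlation_of_invertible:
  fixes A B :: "real^'n^'n"
  assumes A: "A \<in> psd_matrices" and B: "B \<in> psd_matrices" and inv: "invertible A"
  shows "\<exists>Q C. orthogonal_matrix Q \<and> C \<in> correlation_matrices \<and>
           share_correlation (transpose Q ** A ** Q) (transpose Q ** B ** Q) C"
proof -
  define R where "R = psd_sqrt A"
  have RR: "R ** R = A" and symR: "transpose R = R"
    using A by (simp_all add: R_def psd_sqrt_square psd_sqrt_symmetric)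
  have invR: "invertible R"
    using inv det_mul[of R R] by (simp add: invertible_det_nz RR)
  then obtain J where JR: "J ** R = mat 1" and RJ: "R ** J = mat 1"
    by (auto simp: invertible_def)
  have symJ: "transpose J = J"
  proof -
    have "transpose J ** R = mat 1"
      using RJ symR by (metis matrix_transpose_mul transpose_mat)
    then show ?thesis
      by (metis RJ matrix_mul_assoc matrix_mul_lid matrix_mul_rid)
  qed
  define G where "G = psd_sqrt (R ** B ** R)"
  have "R ** B ** R \<in> psd_matrices"
    using psd_matrices_congruence[OF B, of R] symR by simp
  then have Gpsd: "G \<in> psd_matrices" and GG: "G ** G = R ** B ** R"
    by (simp_all add: G_def psd_sqrt_psd psd_sqrt_square)
  define T where "T = J ** G ** J"
  have "T \<in> psd_matrices"
    using psd_matrices_congruence[OF Gpsd, of J] symJ by (simp add: T_def)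
  then obtain Q f where Q: "orthogonal_matrix Q" and f: "\<And>i. 0 \<le> f i"
      and T: "T = Q ** diag_matrix f ** transpose Q"
    using psd_diagonalisation by blast
  have QQ: "transpose Q ** Q = mat 1" using Q by (simp add: orthogonal_matrix)
  \<comment> \<open>\<open>T A T = J G (J R) (R J) G J\<close> collapses to \<open>J (R B R) J\<close>.\<close>
  have TAT: "T ** A ** T = B"
  proof -
    have "T ** A ** T = J ** G ** (J ** R) ** (R ** J) ** G ** J"
      by (simp only: T_def RR[symmetric] matrix_mul_assoc)
    also have "\<dots> = J ** (G ** G) ** J"
      by (simp add: JR RJ matrix_mul_assoc)
    also have "\<dots> = (J ** R) ** B ** (R ** J)"
      by (simp only: GG matrix_mul_assoc)
    finally show ?thesis by (simp add: JR RJ)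
  qed
  define A' where "A' = transpose Q ** A ** Q"
  define B' where "B' = transpose Q ** B ** Q"
  have A': "A' \<in> psd_matrices" and B': "B' \<in> psd_matrices"
    using psd_matrices_congruence[OF A, of "transpose Q"] psd_matrices_congruence[OF B, of "transpose Q"]
    by (simp_all add: A'_def B'_def)
  have B'eq: "B' = diag_matrix f ** A' ** diag_matrix f"
  proof -
    have "B' = (transpose Q ** Q) ** diag_matrix f ** transpose Q ** A ** Q **
        diag_matrix f ** (transpose Q ** Q)"
      by (simp only: B'_def TAT[symmetric] T matrix_mul_assoc)
    then show ?thesis by (simp add: QQ A'_def matrix_mul_assoc)
  qed
  have pos: "0 < A' $ i $ i" for i
  proof -
    have "invertible (R ** Q)"
      using invR Q by (intro invertible_mult) (auto simp: orthogonal_matrix_def invertible_def)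
    then have "(R ** Q) *v axis i 1 \<noteq> 0"
      by (metis axis_eq_0_iff invertible_def matrix_vector_mul_assoc matrix_vector_mul_lid
          matrix_vector_mult_0_right zero_neq_one)
    then have "0 < ((R ** Q) *v axis i 1) \<bullet> ((R ** Q) *v axis i 1)"
      by simp
    also have "\<dots> = axis i 1 \<bullet> ((transpose (R ** Q) ** (R ** Q)) *v axis i 1)"
      by (simp only: inner_matrix_vector_transpose matrix_vector_mul_assoc)
    also have "transpose (R ** Q) ** (R ** Q) = A'"
      by (simp only: matrix_transpose_mul symR A'_def RR[symmetric] matrix_mul_assoc)
    finally show ?thesis
      by (simp add: inner_axis' matrix_vector_mult_basis column_def)
  qed
  define D where "D = diag_matrix (\<lambda>i. 1 / sqrt (A' $ i $ i))"
  define C where "C = D ** A' ** D"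
  have Cij: "C $ i $ j = A' $ i $ j / (sqrt (A' $ i $ i) * sqrt (A' $ j $ j))" for i j
    by (simp add: C_def D_def matrix_mult_diag_matrix diag_matrix_mult_matrix)
  have "C \<in> psd_matrices"
    using psd_matrices_congruence[OF A', of D] by (simp add: C_def D_def)
  then have "C \<in> correlation_matrices"
    using pos by (auto simp: correlation_matrices_def Cij less_imp_neq[symmetric] abs_of_pos)
  moreover have "share_correlation A' B' C"
    unfolding share_correlation_iff[OF A' B']
  proof (intro conjI allI)
    have nz: "sqrt (A' $ i $ i) \<noteq> 0" for i using pos[of i] by simp
    show 1: "A' $ i $ j = sqrt (A' $ i $ i) * C $ i $ j * sqrt (A' $ j $ j)" for i j
      using nz[of i] nz[of j] by (simp add: Cij)
    have Bij: "B' $ i $ j = f i * A' $ i $ j * f j" for i j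
      by (simp add: B'eq matrix_mult_diag_matrix diag_matrix_mult_matrix)
    have rootB: "sqrt (B' $ i $ i) = f i * sqrt (A' $ i $ i)" for i
      using f[of i] by (simp add: Bij real_sqrt_mult)
    show "B' $ i $ j = sqrt (B' $ i $ i) * C $ i $ j * sqrt (B' $ j $ j)" for i j
    proof -
      have "B' $ i $ j = f i * (sqrt (A' $ i $ i) * C $ i $ j * sqrt (A' $ j $ j)) * f j"
        using Bij[of i j] 1[of i j] by (simp only:)
      then show ?thesis unfolding rootB by (simp add: mult_ac)
    qed
  qed
  ultimately show ?thesis
    using Q by (auto simp: A'_def B'_def)
qed

lemma bounded_of_entries_le_1:
  fixes S :: "(real^'n^'m) set"
  assumes "\<And>M i j. M \<in> S \<Longrightarrow> \<bar>M $ i $ j\<bar> \<le> 1"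
  shows "bounded S"
proof (rule boundedI)
  fix M assume M: "M \<in> S"
  have "norm M \<le> (\<Sum>i\<in>UNIV. norm (M $ i))"
    unfolding norm_vec_def by (rule L2_set_le_sum) simp
  also have "\<dots> \<le> (\<Sum>i\<in>(UNIV::'m set). \<Sum>j\<in>(UNIV::'n set). \<bar>M $ i $ j\<bar>)"
    by (intro sum_mono norm_le_l1_cart)
  also have "\<dots> \<le> (\<Sum>i\<in>(UNIV::'m set). \<Sum>j\<in>(UNIV::'n set). 1)"
    using assms[OF M] by (intro sum_mono) auto
  finally show "norm M \<le> real (CARD('m) * CARD('n))" by simp
qed

lemma compact_orthogonal_matrices: "compact {Q :: real^'n^'n. orthogonal_matrix Q}"
proof -
  have "{Q :: real^'n^'n. orthogonal_matrix Q} =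
      {Q. \<forall>i j. (\<Sum>k\<in>UNIV. Q $ k $ i * Q $ k $ j) = (if i = j then 1 else 0)}"
    by (simp add: orthogonal_matrix matrix_matrix_mult_def transpose_def mat_def vec_eq_iff)
  moreover have "closed \<dots>"
    by (intro closed_Collect_all closed_Collect_eq continuous_intros)
  moreover have "bounded {Q :: real^'n^'n. orthogonal_matrix Q}"
  proof (rule bounded_of_entries_le_1)
    fix Q :: "real^'n^'n" and i j assume "Q \<in> {Q. orthogonal_matrix Q}"
    then have "norm (row i Q) = 1"
      by (simp add: orthogonal_matrix_orthonormal_rows)
    then show "\<bar>Q $ i $ j\<bar> \<le> 1"
      using component_le_norm_cart[of "row i Q" j] by (simp add: row_def)
  qed
  ultimately show ?thesis by (simp add: compact_eq_bounded_closed)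
qed

lemma compact_correlation_matrices: "compact (correlation_matrices :: (real^'n^'n) set)"
proof -
  have "(correlation_matrices :: (real^'n^'n) set) =
      {C. (\<forall>i j. C $ j $ i = C $ i $ j) \<and>
          (\<forall>x. 0 \<le> (\<Sum>i\<in>UNIV. x $ i * (\<Sum>j\<in>UNIV. C $ i $ j * x $ j))) \<and> (\<forall>i. C $ i $ i = 1)}"
    by (auto simp: correlation_matrices_def psd_matrices_def transpose_def vec_eq_iff
        matrix_vector_mult_def inner_vec_def)
  moreover have "closed \<dots>"
    by (intro closed_Collect_conj closed_Collect_all closed_Collect_eq closed_Collect_le
        continuous_intros)
  moreover have "bounded (correlation_matrices :: (real^'n^'n) set)"
  proof (rule bounded_of_entries_le_1)
    fix C :: "real^'n^'n" and i j assume C: "C \<in> correlation_matrices"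
    then have psd: "\<And>x. 0 \<le> x \<bullet> (C *v x)" and d: "\<And>i. C $ i $ i = 1" and s: "C $ j $ i = C $ i $ j"
      by (auto simp: correlation_matrices_def psd_matrices_def transpose_def vec_eq_iff)
    have ax: "axis k 1 \<bullet> (C *v axis l 1) = C $ k $ l" for k l
      by (simp add: inner_axis' matrix_vector_mult_basis column_def)
    show "\<bar>C $ i $ j\<bar> \<le> 1"
      using psd[of "axis i 1 + axis j 1"] psd[of "axis i 1 - axis j 1"]
      by (simp add: matrix_vector_right_distrib matrix_vector_mult_diff_distrib inner_add_left
          inner_add_right inner_diff_left inner_diff_right ax d s)
  qed
  ultimately show ?thesis by (simp add: compact_eq_bounded_closed)
qed

lemma tendsto_matrix_matrix_mult:
  fixes F :: "'a \<Rightarrow> real^'n^'m" and G :: "'a \<Rightarrow> real^'k^'n"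
  assumes "(F \<longlongrightarrow> A) X" "(G \<longlongrightarrow> B) X"
  shows "((\<lambda>x. F x ** G x) \<longlongrightarrow> A ** B) X"
  unfolding matrix_matrix_mult_def
  by (intro vec_tendstoI) (auto intro!: tendsto_intros assms)

lemma tendsto_transpose:
  fixes F :: "'a \<Rightarrow> real^'n^'m"
  assumes "(F \<longlongrightarrow> A) X"
  shows "((\<lambda>x. transpose (F x)) \<longlongrightarrow> transpose A) X"
  unfolding transpose_def by (intro vec_tendstoI) (auto intro!: tendsto_intros assms)

text \<open>The perturbations \<open>A + I / (k + 1)\<close> are invertible. The pairs \<open>(Q, C)\<close> obtained for them lie in
  a compact set, and sharing a correlation matrix is a closed condition once it is written entrywise
  with square roots of diagonal entries.\<close>

theorem share_correlation_exists:
  fixes A B :: "real^'n^'n"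
  assumes A: "A \<in> psd_matrices" and B: "B \<in> psd_matrices"
  shows "\<exists>Q C. orthogonal_matrix Q \<and> C \<in> correlation_matrices \<and>
           share_correlation (transpose Q ** A ** Q) (transpose Q ** B ** Q) C"
proof -
  define A' where "A' k = A + (1 / real (Suc k)) *\<^sub>R mat 1" for k
  have quad: "x \<bullet> (A' k *v x) = x \<bullet> (A *v x) + (x \<bullet> x) / real (Suc k)" for k x
    by (simp add: A'_def matrix_vector_mult_add_rdistrib inner_add_right
        flip: scaleR_matrix_vector_assoc)
  have A'psd: "A' k \<in> psd_matrices" for k
    using A unfolding psd_matrices_def mem_Collect_eq quad
    by (auto simp: A'_def transpose_def vec_eq_iff mat_def intro!: add_nonneg_nonneg)
  have inv: "invertible (A' k)" for k
  proof -
    have "x = 0" if "A' k *v x = 0" for x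
    proof -
      have "x \<bullet> (A *v x) + (x \<bullet> x) / real (Suc k) = 0" using that quad[of x k] by simp
      moreover have "0 \<le> x \<bullet> (A *v x)" using A by (simp add: psd_matrices_def)
      moreover have "0 \<le> (x \<bullet> x) / real (Suc k)" by simp
      ultimately have "(x \<bullet> x) / real (Suc k) = 0" by linarith
      then show ?thesis by simp
    qed
    then show ?thesis
      by (meson invertible_left_inverse matrix_left_invertible_ker)
  qed
  obtain Q C where QC: "\<And>k. orthogonal_matrix (Q k)" "\<And>k. C k \<in> correlation_matrices"
      "\<And>k. share_correlation (transpose (Q k) ** A' k ** Q k) (transpose (Q k) ** B ** Q k) (C k)"
    using share_correlation_of_invertible[OF A'psd B inv] by metis
  have cpt: "compact ({Q :: real^'n^'n. orthogonal_matrix Q} \<times> (correlation_matrices :: (real^'n^'n) set))"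
    by (intro compact_Times compact_orthogonal_matrices compact_correlation_matrices)
  have mem: "\<forall>k. (Q k, C k) \<in> {Q. orthogonal_matrix Q} \<times> correlation_matrices"
    using QC by auto
  obtain L r where L: "L \<in> {Q. orthogonal_matrix Q} \<times> correlation_matrices"
      and r: "strict_mono r" "((\<lambda>k. (Q k, C k)) \<circ> r) \<longlonglongrightarrow> L"
    by (rule seq_compactE[OF compact_imp_seq_compact[OF cpt] mem])
  obtain P E where PE: "L = (P, E)" by fastforce
  have Qlim: "(\<lambda>k. Q (r k)) \<longlonglongrightarrow> P" and Clim: "(\<lambda>k. C (r k)) \<longlonglongrightarrow> E"
    using tendsto_fst[OF r(2)] tendsto_snd[OF r(2)] by (simp_all add: PE comp_def)
  have "A' \<longlonglongrightarrow> A"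
    unfolding A'_def
    using tendsto_add[OF tendsto_const tendsto_scaleR[OF LIMSEQ_inverse_real_of_nat tendsto_const], of A "mat 1"]
    by (simp add: inverse_eq_divide)
  then have A'lim: "(\<lambda>k. A' (r k)) \<longlonglongrightarrow> A"
    using LIMSEQ_subseq_LIMSEQ[OF _ r(1)] by (fastforce simp: comp_def)
  have conj_psd: "transpose U ** M ** U \<in> psd_matrices" if "M \<in> psd_matrices" for U M :: "real^'n^'n"
    using psd_matrices_congruence[OF that, of "transpose U"] by simp
  have limit: "(transpose P ** M ** P) $ i $ j =
      sqrt ((transpose P ** M ** P) $ i $ i) * E $ i $ j * sqrt ((transpose P ** M ** P) $ j $ j)"
    if lim: "(\<lambda>k. F (r k)) \<longlonglongrightarrow> M"
      and eq: "\<And>k. (transpose (Q k) ** F k ** Q k) $ i $ j =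
        sqrt ((transpose (Q k) ** F k ** Q k) $ i $ i) * C k $ i $ j *
        sqrt ((transpose (Q k) ** F k ** Q k) $ j $ j)"
    for F M i j
  proof -
    have l: "(\<lambda>k. transpose (Q (r k)) ** F (r k) ** Q (r k)) \<longlonglongrightarrow> transpose P ** M ** P"
      by (intro tendsto_matrix_matrix_mult tendsto_transpose Qlim lim)
    have "(\<lambda>k. (transpose (Q (r k)) ** F (r k) ** Q (r k)) $ i $ j) \<longlonglongrightarrow>
        sqrt ((transpose P ** M ** P) $ i $ i) * E $ i $ j * sqrt ((transpose P ** M ** P) $ j $ j)"
      unfolding eq by (intro tendsto_intros l Clim)
    moreover have "(\<lambda>k. (transpose (Q (r k)) ** F (r k) ** Q (r k)) $ i $ j) \<longlonglongrightarrow>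
        (transpose P ** M ** P) $ i $ j"
      by (intro tendsto_intros l)
    ultimately show ?thesis using LIMSEQ_unique by blast
  qed
  have "share_correlation (transpose P ** A ** P) (transpose P ** B ** P) E"
    using QC(3) unfolding share_correlation_iff[OF conj_psd[OF A'psd] conj_psd[OF B]]
      share_correlation_iff[OF conj_psd[OF A] conj_psd[OF B]]
    by (intro conjI allI limit[OF A'lim] limit[OF tendsto_const]) blast+
  then show ?thesis using L PE by auto
qed

section \<open>The trace term of the Bures-Wasserstein distance\<close>

lemma trace_orthogonal_conjugate:
  fixes Q :: "real^'n^'n"
  assumes "orthogonal_matrix Q"
  shows "trace (Q ** M ** transpose Q) = trace M"
  using assms by (subst trace_mul_sym) (simp add: orthogonal_matrix matrix_mul_assoc)

lemma trace_diag_matrix_mult: "trace (diag_matrix f ** M) = (\<Sum>i\<in>UNIV. f i * M $ i $ i)"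
  by (simp add: trace_def diag_matrix_mult_matrix)

text \<open>Put \<open>X = C\<^sup>1\<^sup>/\<^sup>2 diag f\<close> and \<open>Y = C\<^sup>1\<^sup>/\<^sup>2 diag g\<close>, so that \<open>S = Q X\<^sup>T X Q\<^sup>T\<close> and
  \<open>T = Q Y\<^sup>T Y Q\<^sup>T\<close>. The point is that \<open>P = X Y\<^sup>T\<close> is itself positive semi-definite. Since
  \<open>S\<^sup>1\<^sup>/\<^sup>2 = Q X\<^sup>T U\<close> for some orthogonal \<open>U\<close>, one gets
  \<open>S\<^sup>1\<^sup>/\<^sup>2 T S\<^sup>1\<^sup>/\<^sup>2 = U\<^sup>T P\<^sup>2 U\<close>, whose square root \<open>U\<^sup>T P U\<close> has the trace of \<open>P\<close>.\<close>

theorem trace_psd_sqrt_product: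
  fixes Q :: "real^'n^'n"
  assumes Q: "orthogonal_matrix Q" and C: "C \<in> psd_matrices"
    and S: "S = Q ** diag_matrix f ** C ** diag_matrix f ** transpose Q"
    and T: "T = Q ** diag_matrix g ** C ** diag_matrix g ** transpose Q"
    and fg: "\<And>i. 0 \<le> f i" "\<And>i. 0 \<le> g i"
  shows "trace (psd_sqrt (psd_sqrt S ** T ** psd_sqrt S)) = (\<Sum>i\<in>UNIV. f i * g i * C $ i $ i)"
proof -
  define H where "H = psd_sqrt C"
  have HH: "H ** H = C" and symH: "transpose H = H"
    using C by (simp_all add: H_def psd_sqrt_square psd_sqrt_symmetric)
  have QQ: "transpose Q ** Q = mat 1" using Q by (simp add: orthogonal_matrix)
  define X where "X = H ** diag_matrix f"
  define Y where "Y = H ** diag_matrix g"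
  have SX: "S = (Q ** transpose X) ** transpose (Q ** transpose X)"
    and TY: "T = (Q ** transpose Y) ** transpose (Q ** transpose Y)"
    by (simp_all add: S T X_def Y_def matrix_transpose_mul symH matrix_mul_assoc flip: HH)
  have Spsd: "S \<in> psd_matrices" unfolding SX by (rule gram_matrix_psd)
  define R where "R = psd_sqrt S"
  have symR: "transpose R = R" and RR: "R ** R = S"
    using Spsd by (simp_all add: R_def psd_sqrt_square psd_sqrt_symmetric)
  obtain U where U: "orthogonal_matrix U" and RU: "R = (Q ** transpose X) ** U"
    using polar_factor_exists[of R "Q ** transpose X"] symR RR SX by auto
  define P where "P = X ** transpose Y"
  have P: "P = H ** diag_matrix (\<lambda>i. f i * g i) ** H"
    by (simp add: P_def X_def Y_def matrix_transpose_mul symH matrix_mul_assoc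
        flip: diag_matrix_mult_diag_matrix)
  have Ppsd: "P \<in> psd_matrices"
    using psd_matrices_congruence[of "diag_matrix (\<lambda>i. f i * g i)" H] fg symH
    by (simp add: P diag_matrix_psd_iff)
  then have symP: "transpose P = P" by (simp add: psd_matrices_def)
  have "psd_sqrt (R ** T ** R) = transpose U ** P ** U"
  proof (rule psd_sqrt_eqI)
    show "transpose U ** P ** U \<in> psd_matrices"
      using psd_matrices_congruence[OF Ppsd, of "transpose U"] by simp
    have "transpose U ** P ** U ** (transpose U ** P ** U) = transpose U ** P ** (U ** transpose U) ** P ** U"
      by (simp only: matrix_mul_assoc)
    also have "\<dots> = transpose U ** P ** transpose P ** U"
      using U by (simp add: orthogonal_matrix_def symP)
    also have "\<dots> = transpose U ** X ** (transpose Q ** Q) ** transpose Y ** Y ** (transpose Q ** Q) ** transpose X ** U"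
      by (simp add: P_def QQ matrix_transpose_mul matrix_mul_assoc)
    also have "\<dots> = transpose R ** T ** R"
      by (simp only: RU TY matrix_transpose_mul transpose_transpose matrix_mul_assoc)
    finally show "transpose U ** P ** U ** (transpose U ** P ** U) = R ** T ** R"
      by (simp add: symR)
  qed
  then have "trace (psd_sqrt (R ** T ** R)) = trace P"
    using trace_orthogonal_conjugate[of "transpose U" P] U by simp
  also have "\<dots> = trace (diag_matrix (\<lambda>i. f i * g i) ** C)"
    unfolding P by (subst trace_mul_sym) (simp add: HH matrix_mul_assoc, subst trace_mul_sym, simp)
  finally show ?thesis by (simp add: R_def trace_diag_matrix_mult)
qed

section \<open>Rotation invariance of Lebesgue measure\<close>

lemma nn_integral_lborel_translate:
  fixes h :: "'a::euclidean_space \<Rightarrow> ennreal"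
  assumes [measurable]: "h \<in> borel_measurable borel"
  shows "(\<integral>\<^sup>+y. h (a + y) \<partial>lborel) = (\<integral>\<^sup>+y. h y \<partial>lborel)"
  by (subst (2) lborel_distr_plus[of a, symmetric]) (simp add: nn_integral_distr)

text \<open>The classical uniqueness argument for translation invariant measures. Let \<open>K\<close> be the unit ball.
  Evaluating the double integral of \<open>1\<^sub>K(x) 1\<^sub>B(x + f y)\<close> in both orders, with a translation in the inner
  variable each time, gives \<open>\<lambda>(K) \<lambda>(f\<^sup>-\<^sup>1 B) = \<lambda>(K) \<lambda>(B)\<close>; here it matters that the ball is
  invariant under \<open>f\<close>.\<close>

theorem lborel_distr_orthogonal_transformation:
  fixes f :: "'a::euclidean_space \<Rightarrow> 'a"
  assumes f: "orthogonal_transformation f"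
  shows "distr lborel borel f = lborel"
proof (rule measure_eqI)
  fix B :: "'a set" assume "B \<in> sets (distr lborel borel f)"
  then have B[measurable]: "B \<in> sets borel" by simp
  define g where "g = inv f"
  have g: "orthogonal_transformation g" using f by (simp add: g_def orthogonal_transformation_inv)
  have fg: "f (g x) = x" and gf: "g (f x) = x" for x
    using orthogonal_transformation_surj[OF f] orthogonal_transformation_inj[OF f]
    by (simp_all add: g_def surj_f_inv_f)
  have linf: "linear f" and ling: "linear g"
    using f g by (simp_all add: orthogonal_transformation_linear)
  have fmeas[measurable]: "f \<in> borel_measurable borel"
    using linf by (intro borel_measurable_continuous_onI linear_continuous_on)
      (simp add: linear_linear)
  have fB: "f -` B \<in> sets borel"
    using measurable_sets[OF fmeas B] by simp
  have [measurable]: "ball (x::'a) r \<in> sets borel" for x r by simp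
  define c where "c = emeasure lborel (ball (0::'a) 1)"
  have c: "emeasure lborel (ball (x::'a) 1) = c" for x
    by (simp add: c_def emeasure_ball)
  have "c \<noteq> 0"
  proof -
    have "unit_ball_vol (real DIM('a)) \<noteq> 0"
      using unit_ball_vol_pos[of "real DIM('a)"] by linarith
    then show ?thesis by (simp add: c_def emeasure_ball)
  qed
  moreover have "c \<noteq> \<infinity>"
    by (simp add: c_def emeasure_ball)
  moreover have "c * emeasure lborel (f -` B) = c * emeasure lborel B"
  proof -
    have "c * emeasure lborel (f -` B) =
        (\<integral>\<^sup>+x. indicator (ball (0::'a) 1) x * emeasure lborel (f -` B) \<partial>lborel)"
    proof -
      have "(\<integral>\<^sup>+x. indicator (ball (0::'a) 1) x * emeasure lborel (f -` B) \<partial>lborel) =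
          (\<integral>\<^sup>+x. indicator (ball (0::'a) 1) x \<partial>lborel) * emeasure lborel (f -` B)"
        by (intro nn_integral_multc borel_measurable_indicator) simp
      also have "(\<integral>\<^sup>+x. indicator (ball (0::'a) 1) x \<partial>lborel) = c"
        unfolding c_def by (rule nn_integral_indicator) simp
      finally show ?thesis by simp
    qed
    also have "\<dots> = (\<integral>\<^sup>+x. (\<integral>\<^sup>+y. indicator (ball 0 1) x * indicator B (x + f y) \<partial>lborel) \<partial>lborel)"
    proof (rule nn_integral_cong)
      fix x :: 'a
      have "emeasure lborel (f -` B) = (\<integral>\<^sup>+y. indicator B (f y) \<partial>lborel)"
        using nn_integral_indicator[of "f -` B" lborel] fB
        by (simp add: indicator_def del: nn_integral_indicator)
      also have "\<dots> = (\<integral>\<^sup>+y. indicator B (f (g x + y)) \<partial>lborel)"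
        by (rule nn_integral_lborel_translate[symmetric]) measurable
      also have "\<dots> = (\<integral>\<^sup>+y. indicator B (x + f y) \<partial>lborel)"
        by (simp add: linear_add[OF linf] fg)
      finally show "indicator (ball 0 1) x * emeasure lborel (f -` B) =
          (\<integral>\<^sup>+y. indicator (ball 0 1) x * indicator B (x + f y) \<partial>lborel)"
        by (simp add: nn_integral_cmult)
    qed
    also have "\<dots> = (\<integral>\<^sup>+y. (\<integral>\<^sup>+x. indicator (ball 0 1) x * indicator B (x + f y) \<partial>lborel) \<partial>lborel)"
      by (rule lborel_pair.Fubini'[symmetric]) measurable
    also have "\<dots> = (\<integral>\<^sup>+y. (\<integral>\<^sup>+x. indicator (ball (0::'a) 1) (x - f y) * indicator B x \<partial>lborel) \<partial>lborel)"
    proof (rule nn_integral_cong)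
      fix y :: 'a
      show "(\<integral>\<^sup>+x. indicator (ball 0 1) x * indicator B (x + f y) \<partial>lborel) =
          (\<integral>\<^sup>+x. indicator (ball (0::'a) 1) (x - f y) * indicator B x \<partial>lborel)"
        by (subst nn_integral_lborel_translate[of _ "- f y", symmetric]) (auto simp: algebra_simps)
    qed
    also have "\<dots> = (\<integral>\<^sup>+x. (\<integral>\<^sup>+y. indicator (ball (0::'a) 1) (x - f y) * indicator B x \<partial>lborel) \<partial>lborel)"
      by (rule lborel_pair.Fubini') measurable
    also have "\<dots> = (\<integral>\<^sup>+x. c * indicator B x \<partial>lborel)"
    proof (rule nn_integral_cong)
      fix x :: 'a
      have "indicator (ball 0 1) (x - f y) = (indicator (ball (g x) 1) y :: ennreal)" for y
      proof -
        have "norm (x - f y) = norm (f (g x - y))" by (simp add: linear_diff[OF linf] fg)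
        then have "norm (x - f y) = dist (g x) y"
          using orthogonal_transformation_norm[OF f] by (simp add: dist_norm)
        then show ?thesis by (simp add: indicator_def)
      qed
      then show "(\<integral>\<^sup>+y. indicator (ball (0::'a) 1) (x - f y) * indicator B x \<partial>lborel) = c * indicator B x"
        by (simp add: nn_integral_multc c)
    qed
    also have "\<dots> = c * emeasure lborel B"
      by (simp add: nn_integral_cmult)
    finally show ?thesis .
  qed
  ultimately have "emeasure lborel (f -` B) = emeasure lborel B"
    by (simp add: ennreal_mult_cancel_left)
  then show "emeasure (distr lborel borel f) B = emeasure lborel B"
    by (simp add: emeasure_distr)
qed simp

section \<open>Standard Gaussian vectors and their affine images\<close>

abbreviation std_normal :: "real measure" where
  "std_normal \<equiv> density lborel (\<lambda>x. ennreal (std_normal_density x))"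

text \<open>As a measure on vectors rather than on a product of function type, so that matrices act on it.\<close>

definition std_gaussian :: "(real^'n) measure" where
  "std_gaussian = distr (\<Pi>\<^sub>M i\<in>(UNIV :: 'n set). std_normal) borel (\<lambda>z. \<chi> i. z i)"

lemma borel_measurable_vec_lambda:
  fixes f :: "'a \<Rightarrow> 'n::finite \<Rightarrow> real"
  assumes "\<And>i. (\<lambda>x. f x i) \<in> borel_measurable M"
  shows "(\<lambda>x. \<chi> i. f x i) \<in> borel_measurable M"
  by (subst borel_measurable_euclidean_space) (auto simp: Basis_vec_def inner_axis assms)

lemma borel_measurable_vec_lambda_PiM:
  assumes "\<And>i. sets (M i) = sets borel"
  shows "(\<lambda>z. \<chi> i. z i) \<in> borel_measurable (\<Pi>\<^sub>M i\<in>(UNIV :: 'n::finite set). (M i :: real measure))"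
proof (rule borel_measurable_vec_lambda)
  fix i
  have "(\<lambda>z. z i) \<in> measurable (\<Pi>\<^sub>M i\<in>(UNIV :: 'n::finite set). M i) (M i)" by simp
  then show "(\<lambda>z. z i) \<in> borel_measurable (\<Pi>\<^sub>M i\<in>(UNIV :: 'n::finite set). M i)"
    using measurable_cong_sets[OF refl assms[of i]] by blast
qed

lemma borel_measurable_matrix_vector_mult [measurable]:
  "(\<lambda>x. A *v x) \<in> borel_measurable borel" for A :: "real^'n^'m"
  by (intro borel_measurable_continuous_onI linear_continuous_on) (simp add: linear_linear)

lemma prob_space_std_normal: "prob_space std_normal"
  by (rule prob_space_normal_density) simp

lemma prob_space_std_gaussian: "prob_space (std_gaussian :: (real^'n) measure)"
  unfolding std_gaussian_def
  by (intro prob_space.prob_space_distr prob_space_PiM prob_space_std_normal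
      borel_measurable_vec_lambda_PiM) simp

lemma sets_std_gaussian [measurable_cong, simp]: "sets std_gaussian = sets borel"
  by (simp add: std_gaussian_def)

lemma space_std_gaussian [simp]: "space std_gaussian = UNIV"
  by (simp add: std_gaussian_def)

lemma gaussian_eq_distr_std_gaussian:
  "gaussian m S = distr std_gaussian borel (\<lambda>x. m + psd_sqrt S *v x)"
  unfolding gaussian_def std_gaussian_def
  by (subst distr_distr) (auto intro: borel_measurable_vec_lambda_PiM simp: comp_def)

lemma lborel_vec_eq_distr_PiM:
  "(lborel :: (real^'n) measure) = distr (\<Pi>\<^sub>M i\<in>(UNIV :: 'n set). lborel) borel (\<lambda>z. \<chi> i. z i)"
proof (rule lborel_eqI)
  interpret product_sigma_finite "\<lambda>_ :: 'n. lborel :: real measure" ..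
  fix l u :: "real^'n" assume le: "\<And>b. b \<in> Basis \<Longrightarrow> l \<bullet> b \<le> u \<bullet> b"
  have le': "l $ i \<le> u $ i" for i
    using le[of "axis i 1"] by (simp add: inner_axis axis_in_Basis_iff)
  have "(\<lambda>z. \<chi> i. z i) -` box l u \<inter> space (\<Pi>\<^sub>M i\<in>(UNIV :: 'n set). lborel) =
      Pi\<^sub>E UNIV (\<lambda>i. {l $ i <..< u $ i})"
    by (auto simp: space_PiM mem_box_cart PiE_def Pi_def)
  then have "emeasure (distr (\<Pi>\<^sub>M i\<in>(UNIV :: 'n set). lborel) borel (\<lambda>z. \<chi> i. z i)) (box l u) =
      (\<Prod>i\<in>UNIV. emeasure lborel {l $ i <..< u $ i})"
    by (simp add: emeasure_distr borel_measurable_vec_lambda_PiM emeasure_PiM)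
  also have "\<dots> = ennreal (\<Prod>i\<in>UNIV. u $ i - l $ i)"
    using le' by (simp add: prod_ennreal)
  also have "(\<Prod>i\<in>UNIV. u $ i - l $ i) = (\<Prod>b\<in>Basis. (u - l) \<bullet> b)"
  proof -
    have B: "(Basis :: (real^'n) set) = (\<lambda>i. axis i 1) ` UNIV" by (auto simp: Basis_vec_def)
    have "inj (\<lambda>i :: 'n. axis i (1::real))" by (simp add: inj_def axis_eq_axis)
    then show ?thesis unfolding B by (subst prod.reindex) (simp_all add: inner_axis)
  qed
  finally show "emeasure (distr (\<Pi>\<^sub>M i\<in>(UNIV :: 'n set). lborel) borel (\<lambda>z. \<chi> i. z i)) (box l u) =
      ennreal (\<Prod>b\<in>Basis. (u - l) \<bullet> b)" .
qed simp

lemma std_gaussian_eq_density: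
  "(std_gaussian :: (real^'n) measure) =
     density lborel (\<lambda>x. ennreal ((1 / sqrt (2 * pi)) ^ CARD('n) * exp (- (norm x)\<^sup>2 / 2)))"
proof -
  let ?P = "\<Pi>\<^sub>M i\<in>(UNIV :: 'n set). (lborel :: real measure)"
  let ?v = "\<lambda>z :: 'n \<Rightarrow> real. \<chi> i. z i"
  let ?d = "\<lambda>z :: 'n \<Rightarrow> real. \<Prod>i\<in>UNIV. ennreal (std_normal_density (z i))"
  let ?g = "\<lambda>x :: real^'n. ennreal ((1 / sqrt (2 * pi)) ^ CARD('n) * exp (- (norm x)\<^sup>2 / 2))"
  interpret L: product_sigma_finite "\<lambda>_ :: 'n. lborel :: real measure" ..
  interpret N: product_sigma_finite "\<lambda>_ :: 'n. std_normal"
    unfolding product_sigma_finite_def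
    using prob_space_std_normal by (auto intro: prob_space_imp_sigma_finite)
  have "(\<Pi>\<^sub>M i\<in>(UNIV :: 'n set). std_normal) = density ?P ?d"
  proof (rule N.PiM_eqI[symmetric])
    show "sets (density ?P ?d) = sets (\<Pi>\<^sub>M i\<in>(UNIV :: 'n set). std_normal)"
      by (simp cong: sets_PiM_cong)
    fix A :: "'n \<Rightarrow> real set" assume "\<And>i. i \<in> UNIV \<Longrightarrow> A i \<in> sets std_normal"
    then have A[measurable]: "A i \<in> sets borel" for i by simp
    have "Pi\<^sub>E UNIV A \<in> sets ?P" by (intro sets_PiM_I_finite) auto
    then have "emeasure (density ?P ?d) (Pi\<^sub>E UNIV A) = (\<integral>\<^sup>+z. ?d z * indicator (Pi\<^sub>E UNIV A) z \<partial>?P)"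
      by (intro emeasure_density) auto
    also have "\<dots> = (\<integral>\<^sup>+z. (\<Prod>i\<in>UNIV. ennreal (std_normal_density (z i)) * indicator (A i) (z i)) \<partial>?P)"
    proof (rule nn_integral_cong)
      fix z :: "'n \<Rightarrow> real"
      have "indicator (Pi\<^sub>E UNIV A) z = (\<Prod>i\<in>UNIV. indicator (A i) (z i) :: ennreal)"
        by (auto simp: indicator_def PiE_def Pi_def prod_zero_iff split: if_splits)
      then show "?d z * indicator (Pi\<^sub>E UNIV A) z =
          (\<Prod>i\<in>UNIV. ennreal (std_normal_density (z i)) * indicator (A i) (z i))"
        by (simp add: prod.distrib)
    qed
    also have "\<dots> = (\<Prod>i\<in>UNIV. \<integral>\<^sup>+x. ennreal (std_normal_density x) * indicator (A i) x \<partial>lborel)"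
      by (rule L.product_nn_integral_prod) auto
    also have "\<dots> = (\<Prod>i\<in>UNIV. emeasure std_normal (A i))"
      by (simp add: emeasure_density)
    finally show "emeasure (density ?P ?d) (Pi\<^sub>E UNIV A) = (\<Prod>i\<in>UNIV. emeasure std_normal (A i))" .
  qed simp
  also have "?d = (\<lambda>z. ?g (?v z))"
  proof
    fix z :: "'n \<Rightarrow> real"
    have "(norm (?v z))\<^sup>2 = (\<Sum>i\<in>UNIV. (z i)\<^sup>2)"
      by (simp add: norm_vec_def L2_set_def sum_nonneg)
    then show "?d z = ?g (?v z)"
      by (simp add: prod_ennreal std_normal_density_def prod.distrib power_divide prod_dividef
          flip: exp_sum) (simp add: exp_sum sum_divide_distrib sum_negf)
  qed
  finally have "std_gaussian = distr (density ?P (\<lambda>z. ?g (?v z))) borel ?v"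
    by (simp add: std_gaussian_def)
  also have "\<dots> = density (distr ?P borel ?v) ?g"
    by (intro density_distr[symmetric] borel_measurable_vec_lambda_PiM) auto
  finally show ?thesis by (simp flip: lborel_vec_eq_distr_PiM)
qed

text \<open>The density depends on the norm alone.\<close>

lemma std_gaussian_orthogonal_invariant:
  fixes U :: "real^'n^'n"
  assumes "orthogonal_matrix U"
  shows "distr std_gaussian borel ((*v) U) = std_gaussian"
proof -
  have U: "orthogonal_transformation ((*v) U)"
    using assms by (simp add: orthogonal_transformation_matrix)
  let ?g = "\<lambda>x :: real^'n. ennreal ((1 / sqrt (2 * pi)) ^ CARD('n) * exp (- (norm x)\<^sup>2 / 2))"
  have "distr (density lborel (\<lambda>x. ?g (U *v x))) borel ((*v) U) = density (distr lborel borel ((*v) U)) ?g"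
    by (intro density_distr[symmetric]) auto
  then show ?thesis
    by (simp add: std_gaussian_eq_density lborel_distr_orthogonal_transformation[OF U]
        orthogonal_transformation_norm[OF U])
qed

lemma std_gaussian_projection:
  "distr (std_gaussian :: (real^('n + 'm::finite)) measure) borel (\<lambda>z. \<chi> i. z $ Inl i) =
     (std_gaussian :: (real^'n) measure)"
proof -
  let ?P = "\<Pi>\<^sub>M i\<in>(UNIV :: ('n + 'm) set). std_normal"
  let ?Q = "\<Pi>\<^sub>M i\<in>(UNIV :: 'n set). std_normal"
  have "distr (std_gaussian :: (real^('n + 'm)) measure) borel (\<lambda>z. \<chi> i. z $ Inl i) =
      distr ?P borel (\<lambda>z. \<chi> i. z (Inl i))"
    unfolding std_gaussian_def
    by (subst distr_distr)
      (auto intro!: borel_measurable_vec_lambda_PiM borel_measurable_vec_lambda simp: comp_def)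
  also have "\<dots> = distr (distr ?P ?Q (\<lambda>z. \<lambda>i\<in>UNIV. z (Inl i))) borel (\<lambda>z. \<chi> i. z i)"
  proof (subst distr_distr)
    show "(\<lambda>z. \<chi> i. z i) \<in> borel_measurable ?Q" by (rule borel_measurable_vec_lambda_PiM) simp
    show "(\<lambda>z. \<lambda>i\<in>UNIV. z (Inl i)) \<in> measurable ?P ?Q" by measurable
  qed (simp add: comp_def restrict_def)
  also have "distr ?P ?Q (\<lambda>z. \<lambda>i\<in>UNIV. z (Inl i)) = ?Q"
    by (rule distr_PiM_reindex) (auto simp: prob_space_std_normal)
  finally show ?thesis by (simp add: std_gaussian_def)
qed

lemma sum_UNIV_Plus: "(\<Sum>k\<in>(UNIV :: ('n::finite + 'm::finite) set). f k) = (\<Sum>i\<in>UNIV. f (Inl i)) + (\<Sum>i\<in>UNIV. f (Inr i))"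
  by (simp add: sum.Plus flip: UNIV_Plus_UNIV)

text \<open>The \<open>n \<times> (n + m)\<close> matrices \<open>W\<close> and \<open>[(W W\<^sup>T)\<^sup>1\<^sup>/\<^sup>2 0]\<close> have the same Gram matrix, hence differ
  by an orthogonal factor on the right, which the standard Gaussian absorbs. The zero block then
  discards the superfluous coordinates.\<close>

theorem std_gaussian_affine_image:
  fixes W :: "real^('n + 'm::finite)^'n"
  shows "distr std_gaussian borel (\<lambda>z. m + W *v z) = gaussian m (W ** transpose W)"
proof -
  define R where "R = psd_sqrt (W ** transpose W)"
  have R: "R ** transpose R = W ** transpose W"
    using gram_matrix_psd[of W] by (simp add: R_def psd_sqrt_symmetric psd_sqrt_square)
  \<comment> \<open>\<open>R'\<close> is \<open>R\<close> padded with zero columns, so that it has the shape of \<open>W\<close>.\<close>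
  define R' :: "real^('n + 'm)^'n" where
    "R' = (\<chi> i k. case k of Inl j \<Rightarrow> R $ i $ j | Inr _ \<Rightarrow> 0)"
  have "R' ** transpose R' = R ** transpose R"
    by (simp add: R'_def vec_eq_iff matrix_matrix_mult_def transpose_def sum_UNIV_Plus)
  then obtain U where U: "orthogonal_matrix U" and W: "W = R' ** U"
    using R polar_factor_exists[of W R'] by auto
  have R'v: "R' *v z = R *v (\<chi> i. z $ Inl i)" for z
    by (simp add: R'_def vec_eq_iff matrix_vector_mult_def sum_UNIV_Plus)
  have [measurable]: "(\<lambda>z :: real^('n + 'm). \<chi> i. z $ Inl i) \<in> borel_measurable borel"
    by (intro borel_measurable_vec_lambda) auto
  have "distr std_gaussian borel (\<lambda>z. m + W *v z) =
      distr (distr std_gaussian borel ((*v) U)) borel (\<lambda>z. m + R' *v z)"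
    by (subst distr_distr) (auto simp: W comp_def matrix_vector_mul_assoc)
  also have "\<dots> = distr std_gaussian borel (\<lambda>z :: real^('n + 'm). m + R *v (\<chi> i. z $ Inl i))"
    by (simp add: std_gaussian_orthogonal_invariant[OF U] R'v)
  also have "\<dots> = distr (distr (std_gaussian :: (real^('n + 'm)) measure) borel (\<lambda>z. \<chi> i. z $ Inl i))
      borel (\<lambda>z. m + R *v z)"
    by (subst distr_distr) (auto simp: comp_def)
  also have "\<dots> = gaussian m (W ** transpose W)"
    by (simp add: std_gaussian_projection gaussian_eq_distr_std_gaussian R_def)
  finally show ?thesis .
qed

section \<open>Second moments\<close>

lemma has_bochner_integral_std_normal:
  "has_bochner_integral std_normal (\<lambda>x. x) 0"
  "has_bochner_integral std_normal (\<lambda>x. x\<^sup>2) 1"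
proof -
  show "has_bochner_integral std_normal (\<lambda>x. x) 0"
    using integrable_std_normal_distribution_moment[of 1] integral_std_normal_distribution_moment_odd[of 1]
    by (simp add: has_bochner_integral_iff)
  show "has_bochner_integral std_normal (\<lambda>x. x\<^sup>2) 1"
    using std_normal_distribution_even_moments[of 1] by (simp add: has_bochner_integral_iff)
qed

lemma has_bochner_integral_std_gaussian_coordinates:
  shows "has_bochner_integral std_gaussian (\<lambda>x :: real^'n. x $ i) 0"
    and "has_bochner_integral std_gaussian (\<lambda>x :: real^'n. x $ i * x $ j) (if i = j then 1 else 0)"
proof -
  let ?P = "\<Pi>\<^sub>M i\<in>(UNIV :: 'n set). std_normal"
  interpret N: prob_space std_normal by (rule prob_space_std_normal)
  interpret P: product_sigma_finite "\<lambda>_ :: 'n. std_normal"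
    unfolding product_sigma_finite_def by (simp add: N.sigma_finite_measure_axioms)
  have product: "has_bochner_integral ?P (\<lambda>z. \<Prod>k\<in>UNIV. h k (z k)) (\<Prod>k\<in>UNIV. c k)"
    if "\<forall>k. has_bochner_integral std_normal (h k) (c k)" for h :: "'n \<Rightarrow> real \<Rightarrow> real" and c
    using that by (simp add: has_bochner_integral_iff P.product_integrable_prod P.product_integral_prod)
  have distr: "has_bochner_integral std_gaussian g c" if "has_bochner_integral ?P (\<lambda>z. g (\<chi> i. z i)) c"
    and "g \<in> borel_measurable borel" for g :: "real^'n \<Rightarrow> real" and c
    using that borel_measurable_vec_lambda_PiM[of "\<lambda>_ :: 'n. std_normal"]
    by (simp add: has_bochner_integral_iff std_gaussian_def integrable_distr_eq integral_distr)
  have one: "has_bochner_integral std_normal (\<lambda>x. 1 :: real) 1"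
    using N.prob_space by (simp add: has_bochner_integral_iff)
  show "has_bochner_integral std_gaussian (\<lambda>x :: real^'n. x $ i) 0"
  proof (rule distr)
    have "has_bochner_integral ?P (\<lambda>z. \<Prod>k\<in>UNIV. if k = i then z k else 1) (\<Prod>k\<in>UNIV. if k = i then 0 else 1)"
      by (rule product) (use has_bochner_integral_std_normal one in auto)
    then show "has_bochner_integral ?P (\<lambda>z. (\<chi> i. z i) $ i) 0"
      by simp
  qed measurable
  show "has_bochner_integral std_gaussian (\<lambda>x :: real^'n. x $ i * x $ j) (if i = j then 1 else 0)"
  proof (rule distr)
    show "has_bochner_integral ?P (\<lambda>z. (\<chi> i. z i) $ i * (\<chi> i. z i) $ j) (if i = j then 1 else 0)"
    proof (cases "i = j")
      case True
      have "\<forall>k. has_bochner_integral std_normal (\<lambda>x. if k = i then x\<^sup>2 else 1) 1"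
      proof
        show "has_bochner_integral std_normal (\<lambda>x. if k = i then x\<^sup>2 else 1) 1" for k
          by (cases "k = i") (use has_bochner_integral_std_normal one in simp_all)
      qed
      from product[OF this] show ?thesis using True by (simp add: power2_eq_square)
    next
      case False
      \<comment> \<open>For \<open>i \<noteq> j\<close> independence turns \<open>E[z\<^sub>i z\<^sub>j]\<close> into a product with the vanishing mean as a factor.\<close>
      have "has_bochner_integral ?P
          (\<lambda>z. \<Prod>k\<in>UNIV. (if k = i then z k else 1) * (if k = j then z k else 1))
          (\<Prod>k\<in>UNIV. if k = i \<or> k = j then 0 else 1)"
        by (rule product) (use has_bochner_integral_std_normal one False in auto)
      moreover have "(\<Prod>k\<in>UNIV. if k = i \<or> k = j then 0 else 1 :: real) = 0"
        by (rule prod_zero) auto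
      ultimately show ?thesis using False by (simp add: prod.distrib)
    qed
  qed measurable
qed

lemma has_bochner_integral_std_gaussian_inner:
  fixes a b :: "real^'n"
  shows "has_bochner_integral std_gaussian (\<lambda>x. a \<bullet> x) 0"
    and "has_bochner_integral std_gaussian (\<lambda>x. (a \<bullet> x) * (b \<bullet> x)) (a \<bullet> b)"
proof -
  have "has_bochner_integral std_gaussian (\<lambda>x. \<Sum>i\<in>UNIV. a $ i * x $ i) (\<Sum>i\<in>(UNIV::'n set). a $ i * 0)"
    by (intro has_bochner_integral_sum has_bochner_integral_mult_right
        has_bochner_integral_std_gaussian_coordinates)
  then show "has_bochner_integral std_gaussian (\<lambda>x. a \<bullet> x) 0"
    by (simp add: inner_vec_def)
  have "has_bochner_integral std_gaussian
      (\<lambda>x. \<Sum>i\<in>UNIV. \<Sum>j\<in>UNIV. (a $ i * b $ j) * (x $ i * x $ j))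
      (\<Sum>i\<in>(UNIV::'n set). \<Sum>j\<in>UNIV. (a $ i * b $ j) * (if i = j then 1 else 0))"
    by (intro has_bochner_integral_sum has_bochner_integral_mult_right
        has_bochner_integral_std_gaussian_coordinates)
  moreover have "(\<Sum>i\<in>UNIV. \<Sum>j\<in>UNIV. (a $ i * b $ j) * (x $ i * x $ j)) = (a \<bullet> x) * (b \<bullet> x)" for x
    by (simp add: inner_vec_def sum_product mult_ac)
  moreover have "(\<Sum>i\<in>UNIV. \<Sum>j\<in>UNIV. (a $ i * b $ j) * (if i = j then 1 else 0)) = a \<bullet> b"
    by (simp add: inner_vec_def if_distrib cong: if_cong)
  ultimately show "has_bochner_integral std_gaussian (\<lambda>x. (a \<bullet> x) * (b \<bullet> x)) (a \<bullet> b)"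
    by simp
qed

lemma has_bochner_integral_gaussian_inner:
  assumes "S \<in> psd_matrices"
  shows "has_bochner_integral (gaussian m S) (\<lambda>x. q \<bullet> (x - m)) 0"
    and "has_bochner_integral (gaussian m S) (\<lambda>x. (q \<bullet> (x - m))\<^sup>2) (q \<bullet> (S *v q))"
proof -
  let ?r = "psd_sqrt S *v q"
  have r: "q \<bullet> (psd_sqrt S *v z) = ?r \<bullet> z" for z
    using inner_matrix_vector_transpose[of "psd_sqrt S" q z] psd_sqrt_symmetric[OF assms] by simp
  have rr: "?r \<bullet> ?r = q \<bullet> (S *v q)"
    by (simp only: r[symmetric] matrix_vector_mul_assoc psd_sqrt_square[OF assms])
  show "has_bochner_integral (gaussian m S) (\<lambda>x. q \<bullet> (x - m)) 0"
    using has_bochner_integral_std_gaussian_inner(1)[of ?r]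
    by (simp add: has_bochner_integral_iff gaussian_eq_distr_std_gaussian integrable_distr_eq integral_distr r)
  show "has_bochner_integral (gaussian m S) (\<lambda>x. (q \<bullet> (x - m))\<^sup>2) (q \<bullet> (S *v q))"
    using has_bochner_integral_std_gaussian_inner(2)[of ?r ?r] rr
    by (simp add: has_bochner_integral_iff gaussian_eq_distr_std_gaussian integrable_distr_eq integral_distr r
        power2_eq_square)
qed

lemma has_bochner_integral_std_gaussian_affine_square:
  "has_bochner_integral std_gaussian (\<lambda>z :: real^'n. (c + a \<bullet> z)\<^sup>2) (c\<^sup>2 + a \<bullet> a)"
proof -
  interpret prob_space "std_gaussian :: (real^'n) measure" by (rule prob_space_std_gaussian)
  have "has_bochner_integral std_gaussian (\<lambda>z :: real^'n. c\<^sup>2 + (2 * c) * (a \<bullet> z) + (a \<bullet> z) * (a \<bullet> z))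
      (c\<^sup>2 + (2 * c) * 0 + a \<bullet> a)"
    by (intro has_bochner_integral_add has_bochner_integral_mult_right
        has_bochner_integral_std_gaussian_inner) (use prob_space in \<open>simp add: has_bochner_integral_iff\<close>)
  then show ?thesis by (simp add: power2_eq_square algebra_simps)
qed

section \<open>The lower bound for the transport cost\<close>

text \<open>The centred part contributes \<open>\<alpha> + \<beta> - 2 \<gamma>\<close> with \<open>\<gamma>\<close> the covariance, and the Cauchy-Schwarz
  inequality \<open>\<gamma> \<le> \<surd>\<alpha> \<surd>\<beta>\<close> bounds it from below.\<close>

lemma (in prob_space) second_moment_of_difference_ge:
  fixes u v :: "'a \<Rightarrow> real"
  assumes u: "has_bochner_integral M u 0" "has_bochner_integral M (\<lambda>x. (u x)\<^sup>2) \<alpha>"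
    and v: "has_bochner_integral M v 0" "has_bochner_integral M (\<lambda>x. (v x)\<^sup>2) \<beta>"
  shows "integrable M (\<lambda>x. (u x - v x + \<delta>)\<^sup>2)"
    and "(sqrt \<alpha> - sqrt \<beta>)\<^sup>2 + \<delta>\<^sup>2 \<le> expectation (\<lambda>x. (u x - v x + \<delta>)\<^sup>2)"
proof -
  have [measurable]: "u \<in> borel_measurable M" "v \<in> borel_measurable M"
    using u(1) v(1) by (auto simp: has_bochner_integral_iff)
  have \<alpha>: "0 \<le> \<alpha>" and \<beta>: "0 \<le> \<beta>"
    using u(2) v(2) by (auto simp: has_bochner_integral_iff)
  have "integrable M (\<lambda>x. u x * v x)"
  proof (rule Bochner_Integration.integrable_bound)
    show "integrable M (\<lambda>x. (u x)\<^sup>2 + (v x)\<^sup>2)"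
      using u(2) v(2) by (simp add: has_bochner_integral_iff)
    have "norm (u x * v x) \<le> norm ((u x)\<^sup>2 + (v x)\<^sup>2)" for x
    proof -
      have "2 * (\<bar>u x\<bar> * \<bar>v x\<bar>) \<le> (u x)\<^sup>2 + (v x)\<^sup>2"
        using sum_squares_bound[of "\<bar>u x\<bar>" "\<bar>v x\<bar>"] by simp
      moreover have "0 \<le> \<bar>u x\<bar> * \<bar>v x\<bar>" by simp
      ultimately have "\<bar>u x\<bar> * \<bar>v x\<bar> \<le> (u x)\<^sup>2 + (v x)\<^sup>2" by linarith
      then show ?thesis by (simp add: abs_mult)
    qed
    then show "AE x in M. norm (u x * v x) \<le> norm ((u x)\<^sup>2 + (v x)\<^sup>2)" by simp
  qed simp
  then obtain \<gamma> where uv: "has_bochner_integral M (\<lambda>x. u x * v x) \<gamma>"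
    by (auto simp: has_bochner_integral_iff)
  \<comment> \<open>Taken with general \<open>s\<close> and \<open>t\<close>: the case \<open>\<delta> = 0\<close> gives the Cauchy-Schwarz inequality, the case \<open>s = t = 1\<close> the claim.\<close>
  have quad: "has_bochner_integral M (\<lambda>x. (s * u x - t * v x + \<delta>)\<^sup>2)
      (s\<^sup>2 * \<alpha> + t\<^sup>2 * \<beta> - 2 * s * t * \<gamma> + \<delta>\<^sup>2)" for s t \<delta>
  proof -
    have "has_bochner_integral M
        (\<lambda>x. s\<^sup>2 * (u x)\<^sup>2 + t\<^sup>2 * (v x)\<^sup>2 - (2 * s * t) * (u x * v x) + ((2 * s * \<delta>) * u x - (2 * t * \<delta>) * v x) + \<delta>\<^sup>2)
        (s\<^sup>2 * \<alpha> + t\<^sup>2 * \<beta> - (2 * s * t) * \<gamma> + ((2 * s * \<delta>) * 0 - (2 * t * \<delta>) * 0) + \<delta>\<^sup>2)"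
      by (intro has_bochner_integral_add has_bochner_integral_diff has_bochner_integral_mult_right
          u v uv) (simp add: has_bochner_integral_iff prob_space)
    moreover have "(s * u x - t * v x + \<delta>)\<^sup>2 = s\<^sup>2 * (u x)\<^sup>2 + t\<^sup>2 * (v x)\<^sup>2 - (2 * s * t) * (u x * v x) +
        ((2 * s * \<delta>) * u x - (2 * t * \<delta>) * v x) + \<delta>\<^sup>2" for x
      by (simp add: power2_eq_square algebra_simps)
    ultimately show ?thesis by simp
  qed
  have nonneg: "0 \<le> s\<^sup>2 * \<alpha> + t\<^sup>2 * \<beta> - 2 * s * t * \<gamma>" for s t
  proof -
    have "0 \<le> expectation (\<lambda>x. (s * u x - t * v x + 0)\<^sup>2)"
      by (intro integral_nonneg_AE) simp
    also have "\<dots> = s\<^sup>2 * \<alpha> + t\<^sup>2 * \<beta> - 2 * s * t * \<gamma> + 0\<^sup>2"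
      by (rule has_bochner_integral_integral_eq[OF quad])
    finally show ?thesis by simp
  qed
  have "\<gamma> \<le> sqrt \<alpha> * sqrt \<beta>"
  proof (rule ccontr)
    assume "\<not> \<gamma> \<le> sqrt \<alpha> * sqrt \<beta>"
    then have less: "sqrt \<alpha> * sqrt \<beta> < \<gamma>" by simp
    then have g: "0 < \<gamma>" using \<alpha> \<beta> by (meson le_less_trans mult_nonneg_nonneg real_sqrt_ge_zero)
    \<comment> \<open>The quadratic form in \<open>(s, t)\<close> is negative at \<open>(\<gamma>, \<alpha>)\<close> unless \<open>\<alpha> = 0\<close>, and then at \<open>(\<beta> + 1, \<gamma>)\<close>.\<close>
    have "\<alpha> * \<beta> < \<gamma>\<^sup>2"
      using power_strict_mono[OF less, of 2] \<alpha> \<beta> by (simp add: power_mult_distrib)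
    moreover have "\<alpha> * (\<gamma>\<^sup>2 - \<alpha> * \<beta>) \<le> 0"
      using nonneg[of \<gamma> \<alpha>] by (simp add: power2_eq_square algebra_simps)
    ultimately have "\<alpha> = 0" using \<alpha> by (simp add: mult_le_0_iff)
    then have "\<gamma>\<^sup>2 * (\<beta> + 2) \<le> 0"
      using nonneg[of "\<beta> + 1" \<gamma>] by (simp add: power2_eq_square algebra_simps)
    then show False using g \<beta> by (simp add: mult_le_0_iff)
  qed
  moreover have "(sqrt \<alpha> - sqrt \<beta>)\<^sup>2 = \<alpha> + \<beta> - 2 * (sqrt \<alpha> * sqrt \<beta>)"
    using \<alpha> \<beta> by (simp add: power2_diff)
  ultimately show "integrable M (\<lambda>x. (u x - v x + \<delta>)\<^sup>2)"
    and "(sqrt \<alpha> - sqrt \<beta>)\<^sup>2 + \<delta>\<^sup>2 \<le> expectation (\<lambda>x. (u x - v x + \<delta>)\<^sup>2)"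
    using quad[of 1 1 \<delta>] by (auto simp: has_bochner_integral_iff)
qed

lemma norm_squared_orthogonal_columns:
  fixes Q :: "real^'n^'n"
  assumes "orthogonal_matrix Q"
  shows "(norm x)\<^sup>2 = (\<Sum>i\<in>UNIV. (column i Q \<bullet> x)\<^sup>2)"
proof -
  have "(norm x)\<^sup>2 = (norm (transpose Q *v x))\<^sup>2"
    using assms orthogonal_transformation_norm[of "(*v) (transpose Q)" x]
    by (simp add: orthogonal_transformation_matrix)
  also have "\<dots> = (\<Sum>i\<in>UNIV. ((transpose Q *v x) $ i)\<^sup>2)"
    by (simp add: norm_vec_def L2_set_def sum_nonneg del: transpose_matrix_vector)
  also have "\<dots> = (\<Sum>i\<in>UNIV. (column i Q \<bullet> x)\<^sup>2)"
    by (simp add: matrix_vector_mul_component column_def transpose_def del: transpose_matrix_vector)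
  finally show ?thesis .
qed

lemma conjugate_diagonal_entry:
  fixes Q :: "real^'n^'n"
  shows "(transpose Q ** A ** Q) $ i $ i = column i Q \<bullet> (A *v column i Q)"
proof -
  have "(transpose Q ** A ** Q) $ i $ i = (\<Sum>k\<in>UNIV. (\<Sum>j\<in>UNIV. Q $ j $ i * A $ j $ k) * Q $ k $ i)"
    by (simp add: matrix_matrix_mult_def transpose_def)
  also have "\<dots> = (\<Sum>j\<in>UNIV. Q $ j $ i * (\<Sum>k\<in>UNIV. A $ j $ k * Q $ k $ i))"
    by (simp add: sum_distrib_left sum_distrib_right mult_ac)
      (subst sum.swap, simp add: mult_ac)
  finally show ?thesis
    by (simp add: inner_vec_def matrix_vector_mult_def column_def)
qed

text \<open>Along each column of \<open>Q\<close> the marginals of a coupling are fixed, so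
  \<open>second_moment_of_difference_ge\<close> applies; the sum of these bounds is the claim.\<close>

theorem transport_cost_coupling_ge:
  fixes Q :: "real^'n^'n"
  assumes Q: "orthogonal_matrix Q" and S: "S \<in> psd_matrices" and T: "T \<in> psd_matrices"
    and P: "P \<in> couplings (gaussian m S) (gaussian l T)"
  shows "ennreal ((norm (m - l))\<^sup>2 + (\<Sum>i\<in>UNIV. (sqrt ((transpose Q ** S ** Q) $ i $ i)
           - sqrt ((transpose Q ** T ** Q) $ i $ i))\<^sup>2)) \<le> transport_cost P"
proof -
  interpret prob_space P using P by (simp add: couplings_def)
  have sets[measurable_cong]: "sets P = sets (borel \<Otimes>\<^sub>M borel)"
    and fstP: "distr P borel fst = gaussian m S" and sndP: "distr P borel snd = gaussian l T"
    using P by (auto simp: couplings_def)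
  have [measurable]: "fst \<in> borel_measurable P" "snd \<in> borel_measurable P"
    by measurable
  let ?q = "\<lambda>i. column i Q"
  define u where "u i p = ?q i \<bullet> (fst p - m)" for i and p :: "(real^'n) \<times> (real^'n)"
  define v where "v i p = ?q i \<bullet> (snd p - l)" for i and p :: "(real^'n) \<times> (real^'n)"
  have u: "has_bochner_integral P (u i) 0"
      "has_bochner_integral P (\<lambda>p. (u i p)\<^sup>2) ((transpose Q ** S ** Q) $ i $ i)" for i
    using has_bochner_integral_gaussian_inner[OF S, where m = m and q = "?q i"] unfolding fstP[symmetric]
    by (simp_all add: has_bochner_integral_iff integrable_distr_eq integral_distr u_def[abs_def]
        conjugate_diagonal_entry)
  have v: "has_bochner_integral P (v i) 0"
      "has_bochner_integral P (\<lambda>p. (v i p)\<^sup>2) ((transpose Q ** T ** Q) $ i $ i)" for i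
    using has_bochner_integral_gaussian_inner[OF T, where m = l and q = "?q i"] unfolding sndP[symmetric]
    by (simp_all add: has_bochner_integral_iff integrable_distr_eq integral_distr v_def[abs_def]
        conjugate_diagonal_entry)
  let ?\<delta> = "\<lambda>i. ?q i \<bullet> (m - l)"
  have split: "(norm (fst p - snd p))\<^sup>2 = (\<Sum>i\<in>UNIV. (u i p - v i p + ?\<delta> i)\<^sup>2)" for p
    unfolding norm_squared_orthogonal_columns[OF Q]
    by (simp add: u_def v_def algebra_simps)
  note ge = second_moment_of_difference_ge[OF u v, of _ _ "?\<delta> _"]
  have int: "integrable P (\<lambda>p. (norm (fst p - snd p))\<^sup>2)"
    unfolding split by (intro Bochner_Integration.integrable_sum ge(1))
  have "(norm (m - l))\<^sup>2 + (\<Sum>i\<in>UNIV. (sqrt ((transpose Q ** S ** Q) $ i $ i)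
           - sqrt ((transpose Q ** T ** Q) $ i $ i))\<^sup>2) =
      (\<Sum>i\<in>UNIV. (sqrt ((transpose Q ** S ** Q) $ i $ i)
           - sqrt ((transpose Q ** T ** Q) $ i $ i))\<^sup>2 + (?\<delta> i)\<^sup>2)"
    by (simp add: norm_squared_orthogonal_columns[OF Q] sum.distrib)
  also have "\<dots> \<le> (\<Sum>i\<in>UNIV. expectation (\<lambda>p. (u i p - v i p + ?\<delta> i)\<^sup>2))"
    by (intro sum_mono ge(2))
  also have "\<dots> = expectation (\<lambda>p. (norm (fst p - snd p))\<^sup>2)"
    unfolding split by (intro Bochner_Integration.integral_sum[symmetric] ge(1))
  finally have "ennreal ((norm (m - l))\<^sup>2 + (\<Sum>i\<in>UNIV. (sqrt ((transpose Q ** S ** Q) $ i $ i)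
           - sqrt ((transpose Q ** T ** Q) $ i $ i))\<^sup>2)) \<le> ennreal (expectation (\<lambda>p. (norm (fst p - snd p))\<^sup>2))"
    by (rule ennreal_leI)
  also have "\<dots> = transport_cost P"
    unfolding transport_cost_def by (intro nn_integral_eq_integral[symmetric] int) simp
  finally show ?thesis .
qed

section \<open>The block Gaussian coupling\<close>

lemma triple_product_entry:
  fixes X :: "real^'n^'m" and Y :: "real^'k^'l"
  shows "(X ** C ** transpose Y) $ i $ j = X $ i \<bullet> (C *v (Y $ j))"
proof -
  have "(X ** C ** transpose Y) $ i $ j = (\<Sum>b\<in>UNIV. (\<Sum>a\<in>UNIV. X $ i $ a * C $ a $ b) * Y $ j $ b)"
    by (simp add: matrix_matrix_mult_def transpose_def)
  also have "\<dots> = (\<Sum>a\<in>UNIV. \<Sum>b\<in>UNIV. X $ i $ a * (C $ a $ b * Y $ j $ b))"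
    by (simp add: sum_distrib_right mult.assoc) (rule sum.swap)
  finally show ?thesis
    by (simp add: inner_vec_def matrix_vector_mult_def sum_distrib_left)
qed

text \<open>The block matrix is \<open>M C M\<^sup>T\<close>, where \<open>M\<close> is \<open>X\<close> stacked on top of \<open>Y\<close>.\<close>

lemma block_matrix_congruence_psd:
  fixes X Y :: "real^'k^'n"
  assumes "C \<in> psd_matrices"
  shows "block_matrix (X ** C ** transpose X) (X ** C ** transpose Y)
           (Y ** C ** transpose X) (Y ** C ** transpose Y) \<in> psd_matrices"
proof -
  define M :: "real^'k^('n + 'n)" where
    "M = (\<chi> k. case k of Inl i \<Rightarrow> X $ i | Inr i \<Rightarrow> Y $ i)"
  have "block_matrix (X ** C ** transpose X) (X ** C ** transpose Y)
           (Y ** C ** transpose X) (Y ** C ** transpose Y) = M ** C ** transpose M"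
    by (auto simp: vec_eq_iff triple_product_entry block_matrix_def M_def split: sum.split)
  then show ?thesis using psd_matrices_congruence[OF assms] by simp
qed

text \<open>The pair is \<open>(m + F Z, l + G Z)\<close> for one standard Gaussian \<open>Z\<close>, where \<open>F\<close> and \<open>G\<close> are the upper
  and the lower half of the square root of the block matrix. The Gram matrices of their rows are the
  four blocks, which determines the marginals and the second moment of the difference.\<close>

lemma
  fixes m l :: "real^'n"
  assumes K: "block_matrix S X Y T \<in> psd_matrices" (is "?K \<in> _")
  shows gaussian_pair_coupling:
      "gaussian_pair (join_vec m l) (block_matrix S X Y T) \<in> couplings (gaussian m S) (gaussian l T)"
    and transport_cost_gaussian_pair:
      "transport_cost (gaussian_pair (join_vec m l) (block_matrix S X Y T)) =
         ennreal ((norm (m - l))\<^sup>2 + (trace S + trace T - trace X - trace Y))"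
proof -
  define R where "R = psd_sqrt ?K"
  define F G :: "real^('n + 'n)^'n" where "F = (\<chi> i. R $ Inl i)" and "G = (\<chi> i. R $ Inr i)"
  have "R ** transpose R = ?K"
    using K by (simp add: R_def psd_sqrt_symmetric psd_sqrt_square)
  moreover have gram: "(A ** transpose B) $ i $ j = A $ i \<bullet> B $ j" for A B :: "real^'k^'l" and i j
    by (simp add: matrix_matrix_mult_def transpose_def inner_vec_def)
  ultimately have RK: "R $ k \<bullet> R $ l = ?K $ k $ l" for k l
    by (metis gram)
  have FF: "F ** transpose F = S" and GG: "G ** transpose G = T"
    by (simp_all add: vec_eq_iff gram F_def G_def RK block_matrix_def)
  have split: "split_vec (join_vec m l + R *v z) = (m + F *v z, l + G *v z)" for z
    by (simp add: split_vec_def join_vec_def F_def G_def vec_eq_iff matrix_vector_mul_component)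
  have split_meas: "split_vec \<in> measurable borel (borel \<Otimes>\<^sub>M borel)"
    unfolding split_vec_def
    by (intro measurable_Pair borel_measurable_vec_lambda) auto
  have pair: "gaussian_pair (join_vec m l) ?K =
      distr std_gaussian (borel \<Otimes>\<^sub>M borel) (\<lambda>z. (m + F *v z, l + G *v z))"
    unfolding gaussian_pair_def gaussian_eq_distr_std_gaussian R_def[symmetric]
    by (subst distr_distr) (use split_meas in \<open>auto simp: comp_def split\<close>)
  have pair_meas: "(\<lambda>z. (m + F *v z, l + G *v z)) \<in> measurable std_gaussian (borel \<Otimes>\<^sub>M borel)"
    by measurable
  show "gaussian_pair (join_vec m l) ?K \<in> couplings (gaussian m S) (gaussian l T)"
    unfolding couplings_def mem_Collect_eq
  proof (intro conjI)
    show "prob_space (gaussian_pair (join_vec m l) ?K)"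
      unfolding pair by (intro prob_space.prob_space_distr prob_space_std_gaussian pair_meas)
    show "sets (gaussian_pair (join_vec m l) ?K) = sets (borel \<Otimes>\<^sub>M borel)"
      by (simp add: pair)
    show "distr (gaussian_pair (join_vec m l) ?K) borel fst = gaussian m S"
      unfolding pair using std_gaussian_affine_image[of m F]
      by (subst distr_distr) (use pair_meas in \<open>auto simp: comp_def FF\<close>)
    show "distr (gaussian_pair (join_vec m l) ?K) borel snd = gaussian l T"
      unfolding pair using std_gaussian_affine_image[of l G]
      by (subst distr_distr) (use pair_meas in \<open>auto simp: comp_def GG\<close>)
  qed
  have int: "has_bochner_integral std_gaussian (\<lambda>z. (norm ((m + F *v z) - (l + G *v z)))\<^sup>2)
      (\<Sum>i\<in>UNIV. ((m - l) $ i)\<^sup>2 + (F $ i - G $ i) \<bullet> (F $ i - G $ i))"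
  proof -
    have "(norm ((m + F *v z) - (l + G *v z)))\<^sup>2 =
        (\<Sum>i\<in>UNIV. ((m - l) $ i + (F $ i - G $ i) \<bullet> z)\<^sup>2)" for z
      by (simp add: norm_vec_def L2_set_def sum_nonneg matrix_vector_mul_component inner_diff_left
          algebra_simps)
    then show ?thesis
      by (simp only:) (intro has_bochner_integral_sum has_bochner_integral_std_gaussian_affine_square)
  qed
  have "transport_cost (gaussian_pair (join_vec m l) ?K) =
      (\<integral>\<^sup>+z. ennreal ((norm ((m + F *v z) - (l + G *v z)))\<^sup>2) \<partial>std_gaussian)"
    unfolding transport_cost_def pair by (subst nn_integral_distr[OF pair_meas]) auto
  also have "\<dots> = ennreal (\<Sum>i\<in>UNIV. ((m - l) $ i)\<^sup>2 + (F $ i - G $ i) \<bullet> (F $ i - G $ i))"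
    using int by (subst nn_integral_eq_integral) (auto simp: has_bochner_integral_iff)
  also have "(\<Sum>i\<in>UNIV. ((m - l) $ i)\<^sup>2 + (F $ i - G $ i) \<bullet> (F $ i - G $ i)) =
      (norm (m - l))\<^sup>2 + (trace S + trace T - trace X - trace Y)"
  proof -
    have "(F $ i - G $ i) \<bullet> (F $ i - G $ i) = S $ i $ i + T $ i $ i - X $ i $ i - Y $ i $ i" for i
      by (simp add: inner_diff_left inner_diff_right F_def G_def RK) (simp add: block_matrix_def)
    then show ?thesis
      by (simp add: norm_vec_def L2_set_def sum_nonneg sum.distrib trace_def sum_subtractf)
  qed
  finally show "transport_cost (gaussian_pair (join_vec m l) ?K) =
      ennreal ((norm (m - l))\<^sup>2 + (trace S + trace T - trace X - trace Y))" .
qed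

section \<open>Optimality of the coupling\<close>

theorem corollary3:
  fixes m\<^sub>\<mu> m\<^sub>\<nu> :: "real^'n" and \<Sigma>\<^sub>\<mu> \<Sigma>\<^sub>\<nu> :: "real^'n^'n"
  assumes "\<Sigma>\<^sub>\<mu> \<in> psd_matrices" and "\<Sigma>\<^sub>\<nu> \<in> psd_matrices"
  shows
    "(\<exists>Q C. orthogonal_matrix Q \<and> C \<in> correlation_matrices \<and>
        share_correlation (transpose Q ** \<Sigma>\<^sub>\<mu> ** Q) (transpose Q ** \<Sigma>\<^sub>\<nu> ** Q) C) \<and>
     (\<forall>Q C D\<^sub>\<mu> D\<^sub>\<nu> K.
        orthogonal_matrix Q \<and> C \<in> correlation_matrices \<and>
        share_correlation (transpose Q ** \<Sigma>\<^sub>\<mu> ** Q) (transpose Q ** \<Sigma>\<^sub>\<nu> ** Q) C \<and>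
        D\<^sub>\<mu> = psd_sqrt (dg (transpose Q ** \<Sigma>\<^sub>\<mu> ** Q)) \<and>
        D\<^sub>\<nu> = psd_sqrt (dg (transpose Q ** \<Sigma>\<^sub>\<nu> ** Q)) \<and>
        K = block_matrix \<Sigma>\<^sub>\<mu> (Q ** D\<^sub>\<mu> ** C ** D\<^sub>\<nu> ** transpose Q)
              (Q ** D\<^sub>\<nu> ** C ** D\<^sub>\<mu> ** transpose Q) \<Sigma>\<^sub>\<nu> \<longrightarrow>
        K \<in> psd_matrices \<and>
        optimal_W2_coupling (gaussian_pair (join_vec m\<^sub>\<mu> m\<^sub>\<nu>) K)
          (gaussian m\<^sub>\<mu> \<Sigma>\<^sub>\<mu>) (gaussian m\<^sub>\<nu> \<Sigma>\<^sub>\<nu>) \<and>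
        (W2 (gaussian m\<^sub>\<mu> \<Sigma>\<^sub>\<mu>) (gaussian m\<^sub>\<nu> \<Sigma>\<^sub>\<nu>))\<^sup>2 =
          (norm (m\<^sub>\<mu> - m\<^sub>\<nu>))\<^sup>2 + (bw \<Sigma>\<^sub>\<mu> \<Sigma>\<^sub>\<nu>)\<^sup>2 \<and>
        (bw \<Sigma>\<^sub>\<mu> \<Sigma>\<^sub>\<nu>)\<^sup>2 =
          (\<Sum>i\<in>UNIV. (sqrt ((transpose Q ** \<Sigma>\<^sub>\<mu> ** Q) $ i $ i)
                     - sqrt ((transpose Q ** \<Sigma>\<^sub>\<nu> ** Q) $ i $ i))\<^sup>2))"
proof (rule conjI)
  show "\<exists>Q C. orthogonal_matrix Q \<and> C \<in> correlation_matrices \<and>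
      share_correlation (transpose Q ** \<Sigma>\<^sub>\<mu> ** Q) (transpose Q ** \<Sigma>\<^sub>\<nu> ** Q) C"
    by (rule share_correlation_exists[OF assms])
next
  let ?M = "gaussian m\<^sub>\<mu> \<Sigma>\<^sub>\<mu>" and ?N = "gaussian m\<^sub>\<nu> \<Sigma>\<^sub>\<nu>"
  show "\<forall>Q C D\<^sub>\<mu> D\<^sub>\<nu> K.
        orthogonal_matrix Q \<and> C \<in> correlation_matrices \<and>
        share_correlation (transpose Q ** \<Sigma>\<^sub>\<mu> ** Q) (transpose Q ** \<Sigma>\<^sub>\<nu> ** Q) C \<and>
        D\<^sub>\<mu> = psd_sqrt (dg (transpose Q ** \<Sigma>\<^sub>\<mu> ** Q)) \<and>
        D\<^sub>\<nu> = psd_sqrt (dg (transpose Q ** \<Sigma>\<^sub>\<nu> ** Q)) \<and>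
        K = block_matrix \<Sigma>\<^sub>\<mu> (Q ** D\<^sub>\<mu> ** C ** D\<^sub>\<nu> ** transpose Q)
              (Q ** D\<^sub>\<nu> ** C ** D\<^sub>\<mu> ** transpose Q) \<Sigma>\<^sub>\<nu> \<longrightarrow>
        K \<in> psd_matrices \<and>
        optimal_W2_coupling (gaussian_pair (join_vec m\<^sub>\<mu> m\<^sub>\<nu>) K) ?M ?N \<and>
        (W2 ?M ?N)\<^sup>2 = (norm (m\<^sub>\<mu> - m\<^sub>\<nu>))\<^sup>2 + (bw \<Sigma>\<^sub>\<mu> \<Sigma>\<^sub>\<nu>)\<^sup>2 \<and>
        (bw \<Sigma>\<^sub>\<mu> \<Sigma>\<^sub>\<nu>)\<^sup>2 =
          (\<Sum>i\<in>UNIV. (sqrt ((transpose Q ** \<Sigma>\<^sub>\<mu> ** Q) $ i $ i)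
                     - sqrt ((transpose Q ** \<Sigma>\<^sub>\<nu> ** Q) $ i $ i))\<^sup>2)"
  proof (intro allI impI, elim conjE)
    fix Q C D E :: "real^'n^'n" and K :: "real^('n + 'n)^('n + 'n)"
    assume Q: "orthogonal_matrix Q" and Ccor: "C \<in> correlation_matrices"
      and share: "share_correlation (transpose Q ** \<Sigma>\<^sub>\<mu> ** Q) (transpose Q ** \<Sigma>\<^sub>\<nu> ** Q) C"
      and D: "D = psd_sqrt (dg (transpose Q ** \<Sigma>\<^sub>\<mu> ** Q))"
      and E: "E = psd_sqrt (dg (transpose Q ** \<Sigma>\<^sub>\<nu> ** Q))"
      and K: "K = block_matrix \<Sigma>\<^sub>\<mu> (Q ** D ** C ** E ** transpose Q)
              (Q ** E ** C ** D ** transpose Q) \<Sigma>\<^sub>\<nu>"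
    define f where "f i = sqrt ((transpose Q ** \<Sigma>\<^sub>\<mu> ** Q) $ i $ i)" for i
    define g where "g i = sqrt ((transpose Q ** \<Sigma>\<^sub>\<nu> ** Q) $ i $ i)" for i
    define L where "L = (norm (m\<^sub>\<mu> - m\<^sub>\<nu>))\<^sup>2 + (\<Sum>i\<in>UNIV. (f i - g i)\<^sup>2)"
    have C: "C \<in> psd_matrices" and C1: "C $ i $ i = 1" for i
      using Ccor by (auto simp: correlation_matrices_def)
    have conj_psd: "transpose Q ** A ** Q \<in> psd_matrices" if "A \<in> psd_matrices" for A
      using psd_matrices_congruence[OF that, of "transpose Q"] by simp
    have Df: "D = diag_matrix f" and Eg: "E = diag_matrix g"
      by (simp_all add: D E psd_sqrt_dg[OF conj_psd] assms f_def[abs_def] g_def[abs_def])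
    have fg: "0 \<le> f i" "0 \<le> g i" for i
      using psd_matrices_diag_nonneg[OF conj_psd] assms by (simp_all add: f_def g_def)
    \<comment> \<open>Undoing the change of basis turns the shared correlation into factorisations of both covariances.\<close>
    have undo: "A = Q ** B ** transpose Q" if "transpose Q ** A ** Q = B" for A B
    proof -
      have "Q ** B ** transpose Q = (Q ** transpose Q) ** A ** (Q ** transpose Q)"
        by (simp only: that[symmetric] matrix_mul_assoc)
      then show ?thesis using Q by (simp add: orthogonal_matrix_def)
    qed
    have "transpose Q ** \<Sigma>\<^sub>\<mu> ** Q = diag_matrix f ** C ** diag_matrix f"
      and "transpose Q ** \<Sigma>\<^sub>\<nu> ** Q = diag_matrix g ** C ** diag_matrix g"
      using share unfolding share_correlation_def D[symmetric] E[symmetric] Df Eg by blast+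
    from this[THEN undo]
    have S: "\<Sigma>\<^sub>\<mu> = Q ** diag_matrix f ** C ** diag_matrix f ** transpose Q"
      and T: "\<Sigma>\<^sub>\<nu> = Q ** diag_matrix g ** C ** diag_matrix g ** transpose Q"
      by (simp_all only: matrix_mul_assoc)
    have tr: "trace (Q ** diag_matrix a ** C ** diag_matrix b ** transpose Q) = (\<Sum>i\<in>UNIV. a i * b i)"
      for a b
    proof -
      have "Q ** diag_matrix a ** C ** diag_matrix b ** transpose Q =
          Q ** (diag_matrix a ** C ** diag_matrix b) ** transpose Q"
        by (simp only: matrix_mul_assoc)
      then have "trace (Q ** diag_matrix a ** C ** diag_matrix b ** transpose Q) =
          trace (diag_matrix a ** C ** diag_matrix b)"
        by (simp add: trace_orthogonal_conjugate[OF Q])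
      then show ?thesis
        by (simp add: trace_def matrix_mult_diag_matrix diag_matrix_mult_matrix C1)
    qed
    have squares: "(\<Sum>i\<in>UNIV. (f i - g i)\<^sup>2) =
        (\<Sum>i\<in>UNIV. f i * f i) + (\<Sum>i\<in>UNIV. g i * g i) - 2 * (\<Sum>i\<in>UNIV. f i * g i)"
    proof -
      have "(f i - g i)\<^sup>2 = f i * f i + g i * g i - 2 * (f i * g i)" for i
        by (simp add: power2_eq_square algebra_simps)
      then show ?thesis by (simp add: sum.distrib sum_subtractf sum_distrib_left)
    qed
    have bw: "(bw \<Sigma>\<^sub>\<mu> \<Sigma>\<^sub>\<nu>)\<^sup>2 = (\<Sum>i\<in>UNIV. (f i - g i)\<^sup>2)"
    proof -
      have "trace (\<Sigma>\<^sub>\<mu> + \<Sigma>\<^sub>\<nu> - 2 *\<^sub>R psd_sqrt (psd_sqrt \<Sigma>\<^sub>\<mu> ** \<Sigma>\<^sub>\<nu> ** psd_sqrt \<Sigma>\<^sub>\<mu>)) =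
          trace \<Sigma>\<^sub>\<mu> + trace \<Sigma>\<^sub>\<nu> - 2 * trace (psd_sqrt (psd_sqrt \<Sigma>\<^sub>\<mu> ** \<Sigma>\<^sub>\<nu> ** psd_sqrt \<Sigma>\<^sub>\<mu>))"
        by (simp add: trace_def sum.distrib sum_subtractf sum_distrib_left)
      also have "\<dots> = (\<Sum>i\<in>UNIV. (f i - g i)\<^sup>2)"
        unfolding squares trace_psd_sqrt_product[OF Q C S T fg]
        by (simp add: C1) (simp only: S T tr)
      finally show ?thesis by (simp add: bw_def sum_nonneg)
    qed
    have Kpsd: "K \<in> psd_matrices"
      using block_matrix_congruence_psd[OF C, of "Q ** D" "Q ** E"] S T
      by (simp add: K matrix_transpose_mul matrix_mul_assoc Df Eg)
    define P where "P = gaussian_pair (join_vec m\<^sub>\<mu> m\<^sub>\<nu>) K"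
    have P: "P \<in> couplings ?M ?N"
      using gaussian_pair_coupling[OF Kpsd[unfolded K]] by (simp add: P_def K)
    have "trace \<Sigma>\<^sub>\<mu> + trace \<Sigma>\<^sub>\<nu> - trace (Q ** D ** C ** E ** transpose Q) -
        trace (Q ** E ** C ** D ** transpose Q) = (\<Sum>i\<in>UNIV. (f i - g i)\<^sup>2)"
    proof -
      have "trace \<Sigma>\<^sub>\<mu> = (\<Sum>i\<in>UNIV. f i * f i)" "trace \<Sigma>\<^sub>\<nu> = (\<Sum>i\<in>UNIV. g i * g i)"
        by (simp_all only: S T tr)
      then show ?thesis by (simp add: squares Df Eg tr mult.commute)
    qed
    then have cost: "transport_cost P = ennreal L"
      using transport_cost_gaussian_pair[OF Kpsd[unfolded K], of m\<^sub>\<mu> m\<^sub>\<nu>]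
      by (simp add: P_def K L_def)
    have inf: "(INF R\<in>couplings ?M ?N. transport_cost R) = ennreal L"
    proof (rule antisym)
      show "(INF R\<in>couplings ?M ?N. transport_cost R) \<le> ennreal L"
        using INF_lower[OF P, of transport_cost] by (simp add: cost)
      show "ennreal L \<le> (INF R\<in>couplings ?M ?N. transport_cost R)"
        using transport_cost_coupling_ge[OF Q assms]
        by (intro INF_greatest) (simp add: L_def f_def g_def)
    qed
    have "0 \<le> L" by (simp add: L_def sum_nonneg)
    then have "(W2 ?M ?N)\<^sup>2 = L" by (simp add: W2_def inf)
    then show "K \<in> psd_matrices \<and>
        optimal_W2_coupling (gaussian_pair (join_vec m\<^sub>\<mu> m\<^sub>\<nu>) K) ?M ?N \<and>
        (W2 ?M ?N)\<^sup>2 = (norm (m\<^sub>\<mu> - m\<^sub>\<nu>))\<^sup>2 + (bw \<Sigma>\<^sub>\<mu> \<Sigma>\<^sub>\<nu>)\<^sup>2 \<and>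
        (bw \<Sigma>\<^sub>\<mu> \<Sigma>\<^sub>\<nu>)\<^sup>2 =
          (\<Sum>i\<in>UNIV. (sqrt ((transpose Q ** \<Sigma>\<^sub>\<mu> ** Q) $ i $ i)
                     - sqrt ((transpose Q ** \<Sigma>\<^sub>\<nu> ** Q) $ i $ i))\<^sup>2)"
      using Kpsd P cost inf bw
      by (auto simp: optimal_W2_coupling_def P_def L_def f_def g_def)
  qed
qed

end
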